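(* The theory of (non-trivially valued) Henselian valued fields of equi-characteristic $0$ in the pure valued field language $\{+,\cdot,\mathcal O_K\}$ is $\omega$-h-minimal.
   Context: Valued fields: valuations are arbitrary non-trivial Krull valuations. $K$ has valuation ring $\mathcal O_K\subsetneq K$ (interpreting the predicate $\mathcal O_K$ of the language); equi-characteristic $0$ means that $K$ and its residue field have characteristic $0$. The value group is written multiplicatively, $\Gamma_K^\times=K^\times/\mathcal O_K^\times$, $\Gamma_K=\Gamma_K^\times\cup\{0\}$, with valuation $|\cdot|\colon K\to\Gamma_K$, $|0|=0$, ordered so that $\mathcal O_K=\{x:|x|\le 1\}$. Leading terms: for $\lambda\le 1$ in $\Gamma_K^\times$ let $\mathrm{RV}_\lambda=K^\times/(1+\{x:|x|<\lambda\})\ \cup\{0\}$ and let $\mathrm{rv}_\lambda\colon K\to\mathrm{RV}_\lambda$ be the quotient map on $K^\times$ extended by $0\mapsto 0$. Write $\mathrm{RV}=\mathrm{RV}_1$. Elements of $\mathrm{RV}_\lambda$ are imaginary elements and may be used as parameters. "$A$-definable" means definable with parameters from $A$. Preparation: a finite non-empty set $C\subset K$ $\lambda$-prepares $X\subset K$ if whether $x\in K$ lies in $X$ depends only on the tuple $(\mathrm{rv}_\lambda(x-c))_{c\in C}$. Hensel minimality: for $\ell\ge 0$ an integer or $\omega$, a (possibly non-complete) theory $\mathcal T$ of valued fields of equi-characteristic $0$ in a language containing $\{+,\cdot,\mathcal O_K\}$ is $\ell$-h-minimal if for every model $K\models\mathcal T$, every $\lambda\le1$ in $\Gamma_K^\times$,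 every $A\subset K$ and every $A'\subset\mathrm{RV}_\lambda$ with $\#A'\le\ell$, every $(A\cup\mathrm{RV}\cup A')$-definable set $X\subset K$ can be $\lambda$-prepared by a finite $A$-definable set $C\subset K$. *)

theory Defs
  imports
    "HOL-Computational_Algebra.Polynomial"
    "HOL-Library.Extended_Nat"
    "HOL-Library.Countable_Set"
begin

section \<open>Valued fields\<close>

definition valuation_ring :: "'a::field set \<Rightarrow> bool" where
  "valuation_ring \<O> \<longleftrightarrow>
     1 \<in> \<O> \<and> (\<forall>x\<in>\<O>. \<forall>y\<in>\<O>. x - y \<in> \<O> \<and> x * y \<in> \<O>) \<and> (\<forall>x. x \<in> \<O> \<or> inverse x \<in> \<O>)"

definition val_units :: "'a::field set \<Rightarrow> 'a set" where
  "val_units \<O> = {u \<in> \<O>. u \<noteq> 0 \<and> inverse u \<in> \<O>}"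

text \<open>The value \<open>|x|\<close> is the coset \<open>x \<O>\<^sup>\<times>\<close>; for \<open>x = 0\<close> this is \<open>{0}\<close>, which serves as the
  element \<open>0\<close> of the value monoid.\<close>

definition val :: "'a::field set \<Rightarrow> 'a \<Rightarrow> 'a set" where
  "val \<O> x = {x * u |u. u \<in> val_units \<O>}"

definition value_group :: "'a::field set \<Rightarrow> 'a set set" where
  "value_group \<O> = {val \<O> x |x. x \<noteq> 0}"

definition val_le :: "'a::field set \<Rightarrow> 'a set \<Rightarrow> 'a set \<Rightarrow> bool" where
  "val_le \<O> \<gamma> \<delta> \<longleftrightarrow> (\<exists>x\<in>\<gamma>. \<exists>y\<in>\<delta>. \<exists>z\<in>\<O>. x = z * y)"

definition val_less :: "'a::field set \<Rightarrow> 'a set \<Rightarrow> 'a set \<Rightarrow> bool" where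
  "val_less \<O> \<gamma> \<delta> \<longleftrightarrow> val_le \<O> \<gamma> \<delta> \<and> \<gamma> \<noteq> \<delta>"

definition values_le_one :: "'a::field set \<Rightarrow> 'a set set" where
  "values_le_one \<O> = {lam \<in> value_group \<O>. val_le \<O> lam (val \<O> 1)}"

definition val_maximal_ideal :: "'a::field set \<Rightarrow> 'a set" where
  "val_maximal_ideal \<O> = {x. val_less \<O> (val \<O> x) (val \<O> 1)}"

text \<open>Non-trivially valued, with \<open>CHAR('a) = 0\<close> and \<open>n \<cdot> 1 \<noteq> 0\<close> in the residue field for all
  \<open>n > 0\<close>.\<close>

definition equichar0_valued_field :: "'a::field set \<Rightarrow> bool" where
  "equichar0_valued_field \<O> \<longleftrightarrow>
     valuation_ring \<O> \<and> \<O> \<noteq> UNIV \<and> CHAR('a) = 0 \<and>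
     (\<forall>n>0. of_nat n \<notin> val_maximal_ideal \<O>)"

definition henselian :: "'a::field set \<Rightarrow> bool" where
  "henselian \<O> \<longleftrightarrow>
     (\<forall>f :: 'a poly. \<forall>a\<in>\<O>. (\<forall>i. coeff f i \<in> \<O>) \<and> poly f a \<in> val_maximal_ideal \<O> \<and>
        poly (pderiv f) a \<notin> val_maximal_ideal \<O> \<longrightarrow>
        (\<exists>b\<in>\<O>. poly f b = 0 \<and> b - a \<in> val_maximal_ideal \<O>))"

text \<open>\<open>rv \<O> lam x\<close> is the coset of \<open>x\<close> modulo \<open>1 + {y. |y| < lam}\<close>; for \<open>x = 0\<close> it is \<open>{0}\<close>.\<close>

definition rv :: "'a::field set \<Rightarrow> 'a set \<Rightarrow> 'a \<Rightarrow> 'a set" where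
  "rv \<O> lam x = {x * (1 + y) |y. val_less \<O> (val \<O> y) lam}"

definition RV :: "'a::field set \<Rightarrow> 'a set \<Rightarrow> 'a set set" where
  "RV \<O> lam = range (rv \<O> lam)"

definition prepares :: "'a::field set \<Rightarrow> 'a set \<Rightarrow> 'a set \<Rightarrow> 'a set \<Rightarrow> bool" where
  "prepares \<O> lam C X \<longleftrightarrow>
     (\<forall>x x'. (\<forall>c\<in>C. rv \<O> lam (x - c) = rv \<O> lam (x' - c)) \<longrightarrow> (x \<in> X \<longleftrightarrow> x' \<in> X))"


section \<open>Languages containing addition, multiplication and the valuation ring\<close>

text \<open>A language is given by the arities of its further symbols; \<open>None\<close> means that the
  symbol does not belong to the language.\<close>

record ('f, 'r) language =
  fun_arity :: "'f \<Rightarrow> nat option"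
  rel_arity :: "'r \<Rightarrow> nat option"

definition pure_language :: "(unit, unit) language" where
  "pure_language = \<lparr>fun_arity = (\<lambda>_. None), rel_arity = (\<lambda>_. None)\<rparr>"

datatype 'f tm =
    Var nat
  | Add "'f tm" "'f tm"
  | Mul "'f tm" "'f tm"
  | Fun 'f "'f tm list"

text \<open>In order to speak about imaginary parameters in \<open>RV\<^sub>\<lambda>\<close>, formulas have two sorts: the field
  \<open>K\<close> and the imaginary sort \<open>RV\<^sub>\<bullet>\<close>, the union of all \<open>RV\<^sub>\<lambda>\<close> with \<open>\<lambda> \<le> 1\<close>. The latter is a quotient of
  \<open>K \<times> K\<close> by a definable equivalence relation without parameters, with quotient map
  \<open>(x, l) \<mapsto> rv\<^bsub>|l|\<^esub>(x)\<close>, which is the term former \<open>RvMap\<close>.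
  Further imaginary sorts would not change the definable subsets of \<open>K\<close>.\<close>

datatype 'f rvtm =
    RvVar nat
  | RvMap "'f tm" "'f tm"

datatype ('f, 'r) fm =
    Eq "'f tm" "'f tm"
  | InO "'f tm"
  | Rel 'r "'f tm list"
  | RvEq "'f rvtm" "'f rvtm"
  | Neg "('f, 'r) fm"
  | And "('f, 'r) fm" "('f, 'r) fm"
  | Exists nat "('f, 'r) fm"
  | RvExists nat "('f, 'r) fm"

fun wf_tm :: "('f, 'r) language \<Rightarrow> 'f tm \<Rightarrow> bool" where
  "wf_tm L (Var i) \<longleftrightarrow> True"
| "wf_tm L (Add s t) \<longleftrightarrow> wf_tm L s \<and> wf_tm L t"
| "wf_tm L (Mul s t) \<longleftrightarrow> wf_tm L s \<and> wf_tm L t"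
| "wf_tm L (Fun f ts) \<longleftrightarrow> fun_arity L f = Some (length ts) \<and> (\<forall>t\<in>set ts. wf_tm L t)"

primrec wf_rvtm :: "('f, 'r) language \<Rightarrow> 'f rvtm \<Rightarrow> bool" where
  "wf_rvtm L (RvVar j) \<longleftrightarrow> True"
| "wf_rvtm L (RvMap t s) \<longleftrightarrow> wf_tm L t \<and> wf_tm L s"

primrec wf_fm :: "('f, 'r) language \<Rightarrow> ('f, 'r) fm \<Rightarrow> bool" where
  "wf_fm L (Eq s t) \<longleftrightarrow> wf_tm L s \<and> wf_tm L t"
| "wf_fm L (InO t) \<longleftrightarrow> wf_tm L t"
| "wf_fm L (Rel r ts) \<longleftrightarrow> rel_arity L r = Some (length ts) \<and> (\<forall>t\<in>set ts. wf_tm L t)"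
| "wf_fm L (RvEq p q) \<longleftrightarrow> wf_rvtm L p \<and> wf_rvtm L q"
| "wf_fm L (Neg \<phi>) \<longleftrightarrow> wf_fm L \<phi>"
| "wf_fm L (And \<phi> \<psi>) \<longleftrightarrow> wf_fm L \<phi> \<and> wf_fm L \<psi>"
| "wf_fm L (Exists i \<phi>) \<longleftrightarrow> wf_fm L \<phi>"
| "wf_fm L (RvExists j \<phi>) \<longleftrightarrow> wf_fm L \<phi>"

text \<open>The formulas of the language itself, without the imaginary sort.\<close>

primrec one_sorted :: "('f, 'r) fm \<Rightarrow> bool" where
  "one_sorted (Eq s t) \<longleftrightarrow> True"
| "one_sorted (InO t) \<longleftrightarrow> True"
| "one_sorted (Rel r ts) \<longleftrightarrow> True"
| "one_sorted (RvEq p q) \<longleftrightarrow> False"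
| "one_sorted (Neg \<phi>) \<longleftrightarrow> one_sorted \<phi>"
| "one_sorted (And \<phi> \<psi>) \<longleftrightarrow> one_sorted \<phi> \<and> one_sorted \<psi>"
| "one_sorted (Exists i \<phi>) \<longleftrightarrow> one_sorted \<phi>"
| "one_sorted (RvExists j \<phi>) \<longleftrightarrow> False"

fun fv_tm :: "'f tm \<Rightarrow> nat set" where
  "fv_tm (Var i) = {i}"
| "fv_tm (Add s t) = fv_tm s \<union> fv_tm t"
| "fv_tm (Mul s t) = fv_tm s \<union> fv_tm t"
| "fv_tm (Fun f ts) = (\<Union>t\<in>set ts. fv_tm t)"

primrec fv_rvtm :: "'f rvtm \<Rightarrow> nat set" where
  "fv_rvtm (RvVar j) = {}"
| "fv_rvtm (RvMap t s) = fv_tm t \<union> fv_tm s"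

primrec fv :: "('f, 'r) fm \<Rightarrow> nat set" where
  "fv (Eq s t) = fv_tm s \<union> fv_tm t"
| "fv (InO t) = fv_tm t"
| "fv (Rel r ts) = (\<Union>t\<in>set ts. fv_tm t)"
| "fv (RvEq p q) = fv_rvtm p \<union> fv_rvtm q"
| "fv (Neg \<phi>) = fv \<phi>"
| "fv (And \<phi> \<psi>) = fv \<phi> \<union> fv \<psi>"
| "fv (Exists i \<phi>) = fv \<phi> - {i}"
| "fv (RvExists j \<phi>) = fv \<phi>"

primrec rvfv_rvtm :: "'f rvtm \<Rightarrow> nat set" where
  "rvfv_rvtm (RvVar j) = {j}"
| "rvfv_rvtm (RvMap t s) = {}"

primrec rvfv :: "('f, 'r) fm \<Rightarrow> nat set" where
  "rvfv (Eq s t) = {}"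
| "rvfv (InO t) = {}"
| "rvfv (Rel r ts) = {}"
| "rvfv (RvEq p q) = rvfv_rvtm p \<union> rvfv_rvtm q"
| "rvfv (Neg \<phi>) = rvfv \<phi>"
| "rvfv (And \<phi> \<psi>) = rvfv \<phi> \<union> rvfv \<psi>"
| "rvfv (Exists i \<phi>) = rvfv \<phi>"
| "rvfv (RvExists j \<phi>) = rvfv \<phi> - {j}"


section \<open>Structures, theories and definable sets\<close>

text \<open>The universe of a structure is the whole field \<open>'a\<close>, whose operations interpret \<open>Add\<close>
  and \<open>Mul\<close>.\<close>

record ('a, 'f, 'r) struct =
  vring :: "'a set"
  fun_int :: "'f \<Rightarrow> 'a list \<Rightarrow> 'a"
  rel_int :: "'r \<Rightarrow> 'a list \<Rightarrow> bool"

primrec eval_tm :: "('a::field, 'f, 'r) struct \<Rightarrow> (nat \<Rightarrow> 'a) \<Rightarrow> 'f tm \<Rightarrow> 'a" where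
  "eval_tm M e (Var i) = e i"
| "eval_tm M e (Add s t) = eval_tm M e s + eval_tm M e t"
| "eval_tm M e (Mul s t) = eval_tm M e s * eval_tm M e t"
| "eval_tm M e (Fun f ts) = fun_int M f (map (eval_tm M e) ts)"

definition RV_all :: "'a::field set \<Rightarrow> 'a set set" where
  "RV_all \<O> = (\<Union>lam\<in>values_le_one \<O>. RV \<O> lam)"

text \<open>The value \<open>{0}\<close> in the case that \<open>0 < |l| \<le> 1\<close> fails is the usual totalisation.\<close>

definition rv_map :: "'a::field set \<Rightarrow> 'a \<Rightarrow> 'a \<Rightarrow> 'a set" where
  "rv_map \<O> x l = (if val \<O> l \<in> values_le_one \<O> then rv \<O> (val \<O> l) x else {0})"

primrec eval_rvtm ::
  "('a::field, 'f, 'r) struct \<Rightarrow> (nat \<Rightarrow> 'a) \<Rightarrow> (nat \<Rightarrow> 'a set) \<Rightarrow> 'f rvtm \<Rightarrow> 'a set" where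
  "eval_rvtm M e \<rho> (RvVar j) = \<rho> j"
| "eval_rvtm M e \<rho> (RvMap t s) = rv_map (vring M) (eval_tm M e t) (eval_tm M e s)"

primrec sat ::
  "('a::field, 'f, 'r) struct \<Rightarrow> (nat \<Rightarrow> 'a) \<Rightarrow> (nat \<Rightarrow> 'a set) \<Rightarrow> ('f, 'r) fm \<Rightarrow> bool" where
  "sat M e \<rho> (Eq s t) \<longleftrightarrow> eval_tm M e s = eval_tm M e t"
| "sat M e \<rho> (InO t) \<longleftrightarrow> eval_tm M e t \<in> vring M"
| "sat M e \<rho> (Rel r ts) \<longleftrightarrow> rel_int M r (map (eval_tm M e) ts)"
| "sat M e \<rho> (RvEq p q) \<longleftrightarrow> eval_rvtm M e \<rho> p = eval_rvtm M e \<rho> q"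
| "sat M e \<rho> (Neg \<phi>) \<longleftrightarrow> \<not> sat M e \<rho> \<phi>"
| "sat M e \<rho> (And \<phi> \<psi>) \<longleftrightarrow> sat M e \<rho> \<phi> \<and> sat M e \<rho> \<psi>"
| "sat M e \<rho> (Exists i \<phi>) \<longleftrightarrow> (\<exists>x. sat M (e(i := x)) \<rho> \<phi>)"
| "sat M e \<rho> (RvExists j \<phi>) \<longleftrightarrow> (\<exists>\<xi>\<in>RV_all (vring M). sat M e (\<rho>(j := \<xi>)) \<phi>)"

definition is_theory :: "('f, 'r) language \<Rightarrow> ('f, 'r) fm set \<Rightarrow> bool" where
  "is_theory L T \<longleftrightarrow> (\<forall>\<phi>\<in>T. wf_fm L \<phi> \<and> one_sorted \<phi> \<and> fv \<phi> = {})"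

definition models :: "('a::field, 'f, 'r) struct \<Rightarrow> ('f, 'r) fm set \<Rightarrow> bool" where
  "models M T \<longleftrightarrow> (\<forall>\<phi>\<in>T. \<forall>e \<rho>. sat M e \<rho> \<phi>)"

text \<open>\<open>X\<close> is definable with parameters from \<open>A \<subseteq> K\<close> and \<open>B \<subseteq> RV\<^sub>\<bullet>\<close>; the variable \<open>0\<close> ranges
  over \<open>X\<close>, all other free variables are parameters.\<close>

definition definable ::
  "('f, 'r) language \<Rightarrow> ('a::field, 'f, 'r) struct \<Rightarrow> 'a set \<Rightarrow> 'a set set \<Rightarrow> 'a set \<Rightarrow> bool" where
  "definable L M A B X \<longleftrightarrow>
     (\<exists>\<phi> e \<rho>. wf_fm L \<phi> \<and> (\<forall>i\<in>fv \<phi> - {0}. e i \<in> A) \<and> (\<forall>j\<in>rvfv \<phi>. \<rho> j \<in> B) \<and>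
        X = {x. sat M (e(0 := x)) \<rho> \<phi>})"


section \<open>Hensel minimality\<close>

definition card_at_most :: "'b set \<Rightarrow> enat \<Rightarrow> bool" where
  "card_at_most S l \<longleftrightarrow> (case l of enat n \<Rightarrow> finite S \<and> card S \<le> n | \<infinity> \<Rightarrow> countable S)"

text \<open>The type argument is the underlying field of the models; \<open>l\<close>-h-minimality is
  \<open>h_minimal TYPE('a) L l T\<close> for all fields \<open>'a\<close>. The value \<open>l = \<infinity>\<close> stands for \<open>\<omega>\<close>.\<close>

definition h_minimal ::
  "'a::field itself \<Rightarrow> ('f, 'r) language \<Rightarrow> enat \<Rightarrow> ('f, 'r) fm set \<Rightarrow> bool" where
  "h_minimal _ L l T \<longleftrightarrow>
     is_theory L T \<and>
     (\<forall>M :: ('a, 'f, 'r) struct. models M T \<longrightarrow>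
        equichar0_valued_field (vring M) \<and>
        (\<forall>lam\<in>values_le_one (vring M).
          (\<forall>A A' X. A' \<subseteq> RV (vring M) lam \<and> card_at_most A' l \<and>
             definable L M A (RV (vring M) (val (vring M) 1) \<union> A') X \<longrightarrow>
             (\<exists>C. finite C \<and> C \<noteq> {} \<and> definable L M A {} C \<and> prepares (vring M) lam C X))))"


section \<open>The theory of Henselian valued fields of equi-characteristic zero\<close>

definition Imp :: "('f, 'r) fm \<Rightarrow> ('f, 'r) fm \<Rightarrow> ('f, 'r) fm" where
  "Imp \<phi> \<psi> = Neg (And \<phi> (Neg \<psi>))"

definition Forall :: "nat \<Rightarrow> ('f, 'r) fm \<Rightarrow> ('f, 'r) fm" where
  "Forall i \<phi> = Neg (Exists i (Neg \<phi>))"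

primrec Forall_ring :: "nat \<Rightarrow> ('f, 'r) fm \<Rightarrow> ('f, 'r) fm" where
  "Forall_ring 0 \<phi> = \<phi>"
| "Forall_ring (Suc k) \<phi> = Forall k (Imp (InO (Var k)) (Forall_ring k \<phi>))"

definition IsZero :: "'f tm \<Rightarrow> ('f, 'r) fm" where
  "IsZero t = Eq (Add t t) t"

definition IsOne :: "'f tm \<Rightarrow> ('f, 'r) fm" where
  "IsOne t = And (Eq (Mul t t) t) (Neg (IsZero t))"

text \<open>In the next two formulas, \<open>k\<close> has to be a variable not occurring in \<open>t\<close>.\<close>

definition IsUnit :: "nat \<Rightarrow> 'f tm \<Rightarrow> ('f, 'r) fm" where
  "IsUnit k t = And (InO t) (Exists k (And (InO (Var k)) (IsOne (Mul t (Var k)))))"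

definition IsSmall :: "nat \<Rightarrow> 'f tm \<Rightarrow> ('f, 'r) fm" where
  "IsSmall k t = And (InO t) (Neg (IsUnit k t))"

primrec SumTm :: "nat \<Rightarrow> (nat \<Rightarrow> 'f tm) \<Rightarrow> 'f tm" where
  "SumTm 0 g = g 0"
| "SumTm (Suc n) g = Add (SumTm n g) (g (Suc n))"

primrec MonTm :: "nat \<Rightarrow> 'f tm \<Rightarrow> 'f tm \<Rightarrow> 'f tm" where
  "MonTm 0 s t = s"
| "MonTm (Suc k) s t = Mul (MonTm k s t) t"

definition field_axioms :: "('f, 'r) fm set" where
  "field_axioms = (let x = Var 0; y = Var 1; z = Var 2 in
    {Forall 0 (Forall 1 (Forall 2 (Eq (Add (Add x y) z) (Add x (Add y z))))),
     Forall 0 (Forall 1 (Eq (Add x y) (Add y x))),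
     Exists 0 (Forall 1 (And (Eq (Add y x) y) (Exists 2 (Eq (Add y z) x)))),
     Forall 0 (Forall 1 (Forall 2 (Eq (Mul (Mul x y) z) (Mul x (Mul y z))))),
     Forall 0 (Forall 1 (Eq (Mul x y) (Mul y x))),
     Exists 0 (And (Neg (IsZero x))
       (Forall 1 (And (Eq (Mul y x) y) (Imp (Neg (IsZero y)) (Exists 2 (Eq (Mul y z) x)))))),
     Forall 0 (Forall 1 (Forall 2 (Eq (Mul x (Add y z)) (Add (Mul x y) (Mul x z)))))})"

definition valuation_axioms :: "('f, 'r) fm set" where
  "valuation_axioms = (let x = Var 0; y = Var 1 in
    {Forall 0 (Imp (IsOne x) (InO x)),
     Forall 0 (Forall 1 (Imp (And (InO x) (InO y)) (And (InO (Add x y)) (InO (Mul x y))))),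
     Forall 0 (Forall 1 (Imp (And (InO x) (IsZero (Add x y))) (InO y))),
     Forall 0 (Forall 1 (Imp (IsOne (Mul x y)) (Neg (And (Neg (InO x)) (Neg (InO y)))))),
     Exists 0 (Neg (InO x))})"

text \<open>The integers \<open>n \<ge> 1\<close> are units of the valuation ring.\<close>

definition equichar0_axioms :: "('f, 'r) fm set" where
  "equichar0_axioms = {Exists 0 (And (InO (Var 0)) (IsOne (SumTm n (\<lambda>_. Var 0)))) |n. True}"

text \<open>Hensel's lemma for polynomials \<open>f\<close> of degree at most \<open>n + 1\<close>: the variable \<open>0\<close> is the
  approximate root, \<open>i + 1\<close> is the coefficient of degree \<open>i\<close>, \<open>n + 3\<close> is the root, \<open>n + 4\<close> is
  the difference, \<open>n + 5\<close> is auxiliary.\<close>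

definition hensel_axiom :: "nat \<Rightarrow> ('f, 'r) fm" where
  "hensel_axiom n = (let f = (\<lambda>t. SumTm (Suc n) (\<lambda>i. MonTm i (Var (i + 1)) t));
      f' = (\<lambda>t. SumTm n (\<lambda>i. SumTm i (\<lambda>_. MonTm i (Var (i + 2)) t)));
      a = Var 0; b = Var (n + 3); d = Var (n + 4) in
    Forall_ring (n + 3) (Imp (And (IsSmall (n + 5) (f a)) (Neg (IsSmall (n + 5) (f' a))))
      (Exists (n + 3) (And (InO b) (And (IsZero (f b))
        (Exists (n + 4) (And (Eq b (Add a d)) (IsSmall (n + 5) d))))))))"

definition henselian_equichar0_theory :: "('f, 'r) fm set" where
  "henselian_equichar0_theory =
     field_axioms \<union> valuation_axioms \<union> equichar0_axioms \<union> range hensel_axiom"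


subsection \<open>The models of the theory\<close>

lemma eval_tm_upd [simp]: "i \<notin> fv_tm t \<Longrightarrow> eval_tm M (e(i := x)) t = eval_tm M e t"
  by (induction t) (auto intro!: arg_cong[where f = "fun_int M _"])

lemma sat_Imp [simp]: "sat M e \<rho> (Imp \<phi> \<psi>) \<longleftrightarrow> (sat M e \<rho> \<phi> \<longrightarrow> sat M e \<rho> \<psi>)"
  by (simp add: Imp_def)

lemma sat_Forall [simp]: "sat M e \<rho> (Forall i \<phi>) \<longleftrightarrow> (\<forall>x. sat M (e(i := x)) \<rho> \<phi>)"
  by (simp add: Forall_def)

lemma sat_IsZero [simp]: "sat M e \<rho> (IsZero t) \<longleftrightarrow> eval_tm M e t = 0"
  using add_cancel_right_right[of "eval_tm M e t" "eval_tm M e t"] by (auto simp: IsZero_def)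

lemma sat_IsOne [simp]: "sat M e \<rho> (IsOne t) \<longleftrightarrow> eval_tm M e t = 1"
  by (auto simp: IsOne_def)

lemma sat_IsUnit [simp]:
  assumes "k \<notin> fv_tm t"
  shows "sat M e \<rho> (IsUnit k t) \<longleftrightarrow> eval_tm M e t \<in> val_units (vring M)"
proof -
  have "(\<exists>x. x \<in> vring M \<and> y * x = 1) \<longleftrightarrow> y \<noteq> 0 \<and> inverse y \<in> vring M" for y
    by (metis inverse_unique mult_zero_left right_inverse zero_neq_one)
  with assms show ?thesis
    by (auto simp: IsUnit_def val_units_def)
qed

lemma sat_IsSmall [simp]:
  assumes "k \<notin> fv_tm t"
  shows "sat M e \<rho> (IsSmall k t) \<longleftrightarrow> eval_tm M e t \<in> vring M - val_units (vring M)"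
  using assms by (simp add: IsSmall_def)

lemma sat_Forall_ring:
  "sat M e \<rho> (Forall_ring k \<phi>) \<longleftrightarrow>
     (\<forall>g. (\<forall>i<k. g i \<in> vring M) \<longrightarrow> sat M (\<lambda>i. if i < k then g i else e i) \<rho> \<phi>)"
proof (induction k arbitrary: e)
  case (Suc k)
  have "sat M e \<rho> (Forall_ring (Suc k) \<phi>) \<longleftrightarrow> (\<forall>x\<in>vring M. \<forall>g. (\<forall>i<k. g i \<in> vring M) \<longrightarrow>
      sat M (\<lambda>i. if i < k then g i else (e(k := x)) i) \<rho> \<phi>)"
    by (auto simp: Suc)
  also have "\<dots> \<longleftrightarrow> (\<forall>g. (\<forall>i<Suc k. g i \<in> vring M) \<longrightarrow>
      sat M (\<lambda>i. if i < Suc k then g i else e i) \<rho> \<phi>)" (is "?L \<longleftrightarrow> ?R")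
  proof
    assume L: ?L
    show ?R
    proof (intro allI impI)
      fix g assume g: "\<forall>i<Suc k. g i \<in> vring M"
      have "(\<lambda>i. if i < k then g i else (e(k := g k)) i) = (\<lambda>i. if i < Suc k then g i else e i)"
        by (auto simp: fun_eq_iff less_Suc_eq)
      with L g show "sat M (\<lambda>i. if i < Suc k then g i else e i) \<rho> \<phi>"
        by (metis less_Suc_eq)
    qed
  next
    assume R: ?R
    show ?L
    proof (intro ballI allI impI)
      fix x g assume x: "x \<in> vring M" and g: "\<forall>i<k. g i \<in> vring M"
      have "(\<lambda>i. if i < k then g i else (e(k := x)) i) =
          (\<lambda>i. if i < Suc k then (g(k := x)) i else e i)"
        by (auto simp: fun_eq_iff less_Suc_eq)
      moreover have "\<forall>i<Suc k. (g(k := x)) i \<in> vring M"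
        using x g by (auto simp: less_Suc_eq)
      ultimately show "sat M (\<lambda>i. if i < k then g i else (e(k := x)) i) \<rho> \<phi>"
        using R by presburger
    qed
  qed
  finally show ?case .
qed simp

lemma eval_SumTm [simp]: "eval_tm M e (SumTm n g) = (\<Sum>i\<le>n. eval_tm M e (g i))"
  by (induction n) auto

lemma eval_MonTm [simp]: "eval_tm M e (MonTm k s t) = eval_tm M e s * eval_tm M e t ^ k"
  by (induction k) (auto simp: mult_ac)

lemma fv_SumTm [simp]: "fv_tm (SumTm n g) = (\<Union>i\<le>n. fv_tm (g i))"
  by (induction n) (auto simp: atMost_Suc)

lemma fv_MonTm [simp]: "fv_tm (MonTm k s t) = fv_tm s \<union> (if k = 0 then {} else fv_tm t)"
  by (induction k) auto

lemma wf_SumTm [simp]: "wf_tm L (SumTm n g) \<longleftrightarrow> (\<forall>i\<le>n. wf_tm L (g i))"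
  by (induction n) (auto simp: le_Suc_eq)

lemma wf_MonTm [simp]: "wf_tm L (MonTm k s t) \<longleftrightarrow> wf_tm L s \<and> (k = 0 \<or> wf_tm L t)"
  by (induction k) auto

lemma fv_derived [simp]:
  "fv (Imp \<phi> \<psi>) = fv \<phi> \<union> fv \<psi>" "fv (Forall i \<phi>) = fv \<phi> - {i}" "fv (IsZero t) = fv_tm t"
  "fv (IsOne t) = fv_tm t" "fv (IsUnit k t) = fv_tm t" "fv (IsSmall k t) = fv_tm t"
  by (auto simp: Imp_def Forall_def IsZero_def IsOne_def IsUnit_def IsSmall_def)

lemma fv_Forall_ring [simp]: "fv (Forall_ring k \<phi>) = fv \<phi> - {..<k}"
proof (induction k)
  case (Suc k)
  have "fv (Forall_ring (Suc k) \<phi>) = {k} \<union> (fv \<phi> - {..<k}) - {k}"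
    by (simp only: Forall_ring.simps fv_derived fv.simps fv_tm.simps Suc)
  also have "\<dots> = fv \<phi> - {..<Suc k}"
    unfolding lessThan_Suc by blast
  finally show ?case .
qed simp

lemma wf_derived [simp]:
  "wf_fm L (Imp \<phi> \<psi>) \<longleftrightarrow> wf_fm L \<phi> \<and> wf_fm L \<psi>" "wf_fm L (Forall i \<phi>) \<longleftrightarrow> wf_fm L \<phi>"
  "wf_fm L (IsZero t) \<longleftrightarrow> wf_tm L t" "wf_fm L (IsOne t) \<longleftrightarrow> wf_tm L t"
  "wf_fm L (IsUnit k t) \<longleftrightarrow> wf_tm L t" "wf_fm L (IsSmall k t) \<longleftrightarrow> wf_tm L t"
  "wf_fm L (Forall_ring k \<phi>) \<longleftrightarrow> wf_fm L \<phi>"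
  by (auto simp: Imp_def Forall_def IsZero_def IsOne_def IsUnit_def IsSmall_def)
     (induction k; simp add: Imp_def Forall_def)+

lemma one_sorted_derived [simp]:
  "one_sorted (Imp \<phi> \<psi>) \<longleftrightarrow> one_sorted \<phi> \<and> one_sorted \<psi>"
  "one_sorted (Forall i \<phi>) \<longleftrightarrow> one_sorted \<phi>"
  "one_sorted (IsZero t)" "one_sorted (IsOne t)" "one_sorted (IsUnit k t)" "one_sorted (IsSmall k t)"
  "one_sorted (Forall_ring k \<phi>) \<longleftrightarrow> one_sorted \<phi>"
  by (auto simp: Imp_def Forall_def IsZero_def IsOne_def IsUnit_def IsSmall_def)
     (induction k; simp add: Imp_def Forall_def)+

lemma fv_hensel_axiom: "fv (hensel_axiom n :: ('f, 'r) fm) = {}"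
proof -
  have mon: "fv_tm (MonTm i (Var j) t) \<subseteq> {..<n + 3} \<union> fv_tm t" if "j < n + 3"
    for i j and t :: "'f tm"
    using that by simp
  have F: "fv_tm (SumTm (Suc n) (\<lambda>i. MonTm i (Var (i + 1)) t)) \<subseteq> {..<n + 3} \<union> fv_tm t"
    for t :: "'f tm"
    unfolding fv_SumTm by (intro UN_least mon) simp
  have F': "fv_tm (SumTm n (\<lambda>i. SumTm i (\<lambda>_. MonTm i (Var (i + 2)) t))) \<subseteq> {..<n + 3} \<union> fv_tm t"
    for t :: "'f tm"
    unfolding fv_SumTm by (intro UN_least mon) simp
  have "0 \<in> {..<n + 3}"
    by simp
  then show ?thesis
    using F[of "Var 0"] F'[of "Var 0"] F[of "Var (n + 3)"]
    unfolding hensel_axiom_def Let_def fv_Forall_ring fv_derived fv.simps fv_tm.simps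
    by blast
qed

lemma is_theory_henselian_equichar0_theory: "is_theory L henselian_equichar0_theory"
proof -
  have "is_theory L field_axioms" "is_theory L valuation_axioms" "is_theory L equichar0_axioms"
    by (auto simp: is_theory_def field_axioms_def valuation_axioms_def equichar0_axioms_def Let_def)
  moreover have "is_theory L (range hensel_axiom)"
    by (auto simp: is_theory_def fv_hensel_axiom) (simp_all add: hensel_axiom_def Let_def)
  ultimately show ?thesis
    by (auto simp: is_theory_def henselian_equichar0_theory_def)
qed

lemma val_maximal_ideal_iff:
  assumes "valuation_ring \<O>"
  shows "x \<in> val_maximal_ideal \<O> \<longleftrightarrow> x \<in> \<O> - val_units \<O>"
proof -
  have mult: "a * b \<in> \<O>" if "a \<in> \<O>" "b \<in> \<O>" for a b
    using assms that by (auto simp: valuation_ring_def)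
  have one: "1 \<in> \<O>"
    using assms by (auto simp: valuation_ring_def)
  have unit1: "1 \<in> val_units \<O>"
    using one by (simp add: val_units_def)
  have unit_mult: "u * v \<in> val_units \<O>" if "u \<in> val_units \<O>" "v \<in> val_units \<O>" for u v
    using that mult by (auto simp: val_units_def)
  have unit_inv: "inverse u \<in> val_units \<O>" if "u \<in> val_units \<O>" for u
    using that by (auto simp: val_units_def)
  have le: "val_le \<O> (val \<O> x) (val \<O> 1) \<longleftrightarrow> x \<in> \<O>"
  proof
    assume "val_le \<O> (val \<O> x) (val \<O> 1)"
    then obtain u v z where *: "u \<in> val_units \<O>" "v \<in> val_units \<O>" "z \<in> \<O>" "x * u = z * v"
      by (auto simp: val_le_def val_def)
    then have "x = z * v * inverse u"
      by (simp add: val_units_def field_simps)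
    with * show "x \<in> \<O>"
      by (auto simp: val_units_def intro!: mult)
  next
    assume "x \<in> \<O>"
    moreover have "x \<in> val \<O> x" "1 \<in> val \<O> 1"
      using unit1 by (force simp: val_def)+
    ultimately show "val_le \<O> (val \<O> x) (val \<O> 1)"
      unfolding val_le_def by (metis mult.right_neutral)
  qed
  have eq: "val \<O> x = val \<O> 1 \<longleftrightarrow> x \<in> val_units \<O>"
  proof
    assume "val \<O> x = val \<O> 1"
    moreover have "x \<in> val \<O> x"
      using unit1 by (force simp: val_def)
    ultimately show "x \<in> val_units \<O>"
      by (auto simp: val_def)
  next
    assume x: "x \<in> val_units \<O>"
    have "\<exists>v. u = x * v \<and> v \<in> val_units \<O>" if "u \<in> val_units \<O>" for u
      using that x unit_mult[OF unit_inv[OF x] that]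
      by (intro exI[of _ "inverse x * u"]) (auto simp: val_units_def)
    with x show "val \<O> x = val \<O> 1"
      by (auto simp: val_def intro: unit_mult)
  qed
  show ?thesis
    by (simp add: val_maximal_ideal_def val_less_def le eq)
qed

lemma models_field_axioms: "models M field_axioms"
proof -
  have 1: "\<exists>x::'a. \<forall>y. y + x = y \<and> (\<exists>z. y + z = x)"
    by (rule exI[of _ 0]) (auto intro: exI[of _ "- _"])
  have 2: "\<exists>x::'a. x \<noteq> 0 \<and> (\<forall>y. y * x = y \<and> (y \<noteq> 0 \<longrightarrow> (\<exists>z. y * z = x)))"
    by (rule exI[of _ 1]) (auto intro: right_inverse)
  show ?thesis
    using 1 2 by (simp add: models_def field_axioms_def Let_def algebra_simps)
qed

lemma models_valuation_axioms:
  "models M valuation_axioms \<longleftrightarrow> valuation_ring (vring M) \<and> vring M \<noteq> UNIV"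
proof -
  let ?O = "vring M"
  have "models M valuation_axioms \<longleftrightarrow>
     1 \<in> ?O \<and> (\<forall>x y. x \<in> ?O \<and> y \<in> ?O \<longrightarrow> x + y \<in> ?O \<and> x * y \<in> ?O) \<and>
     (\<forall>x y. x \<in> ?O \<and> x + y = 0 \<longrightarrow> y \<in> ?O) \<and>
     (\<forall>x y. x * y = 1 \<longrightarrow> x \<in> ?O \<or> y \<in> ?O) \<and> (\<exists>x. x \<notin> ?O)"
    by (simp add: models_def valuation_axioms_def Let_def)
  also have "(\<forall>x y. x \<in> ?O \<and> x + y = 0 \<longrightarrow> y \<in> ?O) \<longleftrightarrow> (\<forall>x\<in>?O. - x \<in> ?O)"
    by (metis add_eq_0_iff)
  also have "1 \<in> ?O \<and> (\<forall>x y. x \<in> ?O \<and> y \<in> ?O \<longrightarrow> x + y \<in> ?O \<and> x * y \<in> ?O) \<and> (\<forall>x\<in>?O. - x \<in> ?O) \<and>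
     (\<forall>x y. x * y = 1 \<longrightarrow> x \<in> ?O \<or> y \<in> ?O) \<and> (\<exists>x. x \<notin> ?O) \<longleftrightarrow>
     valuation_ring ?O \<and> ?O \<noteq> UNIV" (is "?L \<longleftrightarrow> ?R")
  proof
    assume L: ?L
    then have "0 \<in> ?O"
      by (metis add.right_inverse)
    with L have "x \<in> ?O \<or> inverse x \<in> ?O" for x
      by (metis right_inverse)
    with L show ?R
      unfolding valuation_ring_def by (metis UNIV_I diff_conv_add_uminus)
  next
    assume R: ?R
    have diff: "x - y \<in> ?O" if "x \<in> ?O" "y \<in> ?O" for x y
      using R that by (auto simp: valuation_ring_def)
    have 0: "0 \<in> ?O"
      using R diff[of 1 1] by (auto simp: valuation_ring_def)
    have neg: "- x \<in> ?O" if "x \<in> ?O" for x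
      using diff[OF 0 that] by simp
    have "x + y \<in> ?O" if "x \<in> ?O" "y \<in> ?O" for x y
      using diff[OF that(1) neg[OF that(2)]] by simp
    moreover have "x \<in> ?O \<or> y \<in> ?O" if "x * y = 1" for x y
      using R that by (metis inverse_unique valuation_ring_def)
    ultimately show ?L
      using R neg by (auto simp: valuation_ring_def)
  qed
  finally show ?thesis .
qed

lemma valuation_ring_of_nat:
  assumes "valuation_ring \<O>"
  shows "of_nat n \<in> \<O>"
proof -
  have diff: "x - y \<in> \<O>" if "x \<in> \<O>" "y \<in> \<O>" for x y
    using assms that by (simp add: valuation_ring_def)
  have 1: "1 \<in> \<O>"
    using assms by (simp add: valuation_ring_def)
  have 0: "0 \<in> \<O>"
    using diff[OF 1 1] by simp
  show ?thesis
  proof (induction n)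
    case (Suc n)
    then show ?case
      using diff[OF 1 diff[OF 0 Suc]] by simp
  qed (simp add: 0)
qed

lemma models_equichar0_axioms:
  assumes "valuation_ring (vring M)"
  shows "models (M :: ('a::field, 'f, 'r) struct) equichar0_axioms \<longleftrightarrow>
    CHAR('a) = 0 \<and> (\<forall>n>0. of_nat n \<notin> val_maximal_ideal (vring M))"
proof -
  let ?O = "vring M"
  have "sat M e \<rho> (Exists 0 (And (InO (Var 0)) (IsOne (SumTm n (\<lambda>_. Var 0))))) \<longleftrightarrow>
      (\<exists>x\<in>?O. of_nat (Suc n) * x = 1)" for n e \<rho>
    by auto
  then have "models M equichar0_axioms \<longleftrightarrow> (\<forall>n. \<exists>x\<in>?O. of_nat (Suc n) * x = 1)"
    unfolding models_def equichar0_axioms_def by blast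
  also have "\<dots> \<longleftrightarrow> (\<forall>n>0. \<exists>x\<in>?O. of_nat n * x = 1)"
    by (metis Suc_pred zero_less_Suc)
  also have "\<dots> \<longleftrightarrow> (\<forall>n>0. of_nat n \<in> val_units ?O)"
  proof -
    have "(\<exists>x\<in>?O. y * x = 1) \<longleftrightarrow> y \<noteq> 0 \<and> inverse y \<in> vring M" for y
      by (metis inverse_unique mult_zero_left right_inverse zero_neq_one)
    then show ?thesis
      using valuation_ring_of_nat[OF assms] by (simp add: val_units_def)
  qed
  also have "\<dots> \<longleftrightarrow> CHAR('a) = 0 \<and> (\<forall>n>0. of_nat n \<notin> val_maximal_ideal ?O)"
    using valuation_ring_of_nat[OF assms]
    by (auto simp: val_maximal_ideal_iff[OF assms] CHAR_eq0_iff val_units_def)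
  finally show ?thesis .
qed

lemma models_hensel_axioms:
  assumes "valuation_ring (vring M)"
  shows "models M (range hensel_axiom) \<longleftrightarrow> henselian (vring M)"
proof -
  let ?O = "vring M" and ?m = "vring M - val_units (vring M)"
  have zero: "0 \<in> ?O"
    using valuation_ring_of_nat[OF assms, of 0] by simp
  define P where "P n c a \<longleftrightarrow>
      (\<Sum>i\<le>Suc n. c i * a ^ i) \<in> ?m \<and> (\<Sum>i\<le>n. of_nat (Suc i) * (c (Suc i) * a ^ i)) \<notin> ?m \<longrightarrow>
      (\<exists>b\<in>?O. (\<Sum>i\<le>Suc n. c i * b ^ i) = 0 \<and> b - a \<in> ?m)" for n a and c :: "nat \<Rightarrow> 'a"
  have ax: "sat M e \<rho> (hensel_axiom n) \<longleftrightarrow>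
      (\<forall>c a. a \<in> ?O \<and> (\<forall>i\<le>Suc n. c i \<in> ?O) \<longrightarrow> P n c a)" for n e \<rho>
  proof -
    have ex: "(\<exists>b. b \<in> ?O \<and> R b \<and> (\<exists>d. b = a + d \<and> d \<in> ?O \<and> d \<notin> val_units ?O)) \<longleftrightarrow>
        (\<exists>b\<in>?O. R b \<and> b - a \<in> ?m)" for R a
      by (metis DiffD1 DiffD2 DiffI diff_add_cancel add_diff_cancel_left')
    have "sat M e \<rho> (hensel_axiom n) \<longleftrightarrow>
      (\<forall>g. (\<forall>i<n+3. g i \<in> ?O) \<longrightarrow> P n (\<lambda>i. g (Suc i)) (g 0))"
      unfolding hensel_axiom_def Let_def sat_Forall_ring P_def ex[symmetric]
      by (simp add: mult_ac cong: sum.cong_simp)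
    also have "\<dots> \<longleftrightarrow> (\<forall>c a. a \<in> ?O \<and> (\<forall>i\<le>Suc n. c i \<in> ?O) \<longrightarrow> P n c a)" (is "?L \<longleftrightarrow> ?R")
    proof
      assume L: ?L
      show ?R
      proof (intro allI impI)
        fix c a assume *: "a \<in> ?O \<and> (\<forall>i\<le>Suc n. c i \<in> ?O)"
        show "P n c a"
          using L[rule_format, of "case_nat a c"] * by (auto split: nat.splits)
      qed
    qed auto
    finally show ?thesis .
  qed
  have poly_sum: "poly f x = (\<Sum>i\<le>Suc n. coeff f i * x ^ i)"
    if "degree f \<le> Suc n" for f :: "'a poly" and x n
    using that unfolding poly_altdef
    by (intro sum.mono_neutral_left) (auto simp: coeff_eq_0)
  have pderiv_sum: "poly (pderiv f) x = (\<Sum>i\<le>n. of_nat (Suc i) * (coeff f (Suc i) * x ^ i))"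
    if "degree f \<le> Suc n" for f :: "'a poly" and x n
  proof -
    have "poly (pderiv f) x = (\<Sum>i\<le>n. coeff (pderiv f) i * x ^ i)"
    proof -
      have "degree (pderiv f) \<le> n"
        using that by (intro degree_le) (simp add: coeff_pderiv coeff_eq_0)
      then show ?thesis
        unfolding poly_altdef by (intro sum.mono_neutral_left) (auto simp: coeff_eq_0)
    qed
    then show ?thesis
      by (simp add: coeff_pderiv mult_ac)
  qed
  have P_poly: "P n (coeff f) a \<longleftrightarrow> (poly f a \<in> val_maximal_ideal ?O \<and>
        poly (pderiv f) a \<notin> val_maximal_ideal ?O \<longrightarrow>
        (\<exists>b\<in>?O. poly f b = 0 \<and> b - a \<in> val_maximal_ideal ?O))"
    if "degree f \<le> Suc n" for f n a
    unfolding P_def poly_sum[OF that] pderiv_sum[OF that] val_maximal_ideal_iff[OF assms] by simp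
  show ?thesis
  proof
    assume "models M (range hensel_axiom)"
    then have *: "P n c a" if "a \<in> ?O" "\<forall>i\<le>Suc n. c i \<in> ?O" for n c a
      using ax that by (force simp: models_def)
    show "henselian ?O"
      unfolding henselian_def
    proof (intro allI ballI impI, elim conjE)
      fix f :: "'a poly" and a
      assume "a \<in> ?O" "\<forall>i. coeff f i \<in> ?O" "poly f a \<in> val_maximal_ideal ?O"
        "poly (pderiv f) a \<notin> val_maximal_ideal ?O"
      then show "\<exists>b\<in>?O. poly f b = 0 \<and> b - a \<in> val_maximal_ideal ?O"
        using *[of a "degree f" "coeff f"] P_poly[of f "degree f" a] by auto
    qed
  next
    assume H: "henselian ?O"
    have "P n c a" if a: "a \<in> ?O" and c: "\<forall>i\<le>Suc n. c i \<in> ?O" for n c a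
    proof -
      define f where "f = Poly (map c [0..<n+2])"
      have cf: "coeff f i = (if i \<le> Suc n then c i else 0)" for i
        by (simp add: f_def coeff_Poly_eq nth_default_def del: upt_Suc)
      have "degree f \<le> Suc n"
        by (rule degree_le) (simp add: cf)
      moreover have "\<forall>i. coeff f i \<in> ?O"
        using c zero by (simp add: cf)
      ultimately have "P n (coeff f) a"
        using H a by (simp add: P_poly henselian_def)
      moreover have "P n (coeff f) a \<longleftrightarrow> P n c a"
        unfolding P_def by (simp add: cf cong: sum.cong_simp)
      ultimately show ?thesis by simp
    qed
    with ax show "models M (range hensel_axiom)"
      by (simp add: models_def)
  qed
qed

theorem models_henselian_equichar0_theory:
  "models M henselian_equichar0_theory \<longleftrightarrow>
     equichar0_valued_field (vring M) \<and> henselian (vring M)"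
proof -
  have "models M (S \<union> T) \<longleftrightarrow> models M S \<and> models M T" for S T
    by (auto simp: models_def)
  then show ?thesis
    using models_field_axioms[of M] models_valuation_axioms[of M]
      models_equichar0_axioms[of M] models_hensel_axioms[of M]
    by (auto simp: henselian_equichar0_theory_def equichar0_valued_field_def)
qed

end

(*
  Leading terms of finitely many polynomials eliminate quantifiers over K, one level k at a time: if
  the leading terms rv_k of sufficiently many polynomial expressions agree at two parameter tuples
  e, e', then for every y there is y' such that the leading terms of prescribed polynomials agree
  at (e, y) and (e', y').  To find y', take a center c nearest to y among 0 and the roots of the
  polynomials and of their iterated derivatives.  By Hensel's lemma the Taylor expansions at c have
  no cancellation at y, since a cancellation would produce a root closer to y.  Hence they can be
  evaluated on leading terms, and y' = c' + (y - c) works for any c' that matches c.  That roots c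
  have matching roots c' is shown by induction on the degree: modulo p only polynomials of smaller
  degree matter, so the root itself is approximated from a center of smaller degree and Hensel's
  lemma turns c' + (y - c) into a root of the matching polynomial.

  Consequently membership in a definable set depends only on the leading terms of finitely many
  polynomials in x over the parameters, whatever the parameters from RV are, and the absence of
  cancellation shows that these leading terms only depend on rv_k (x - c) for c = 0 and c a root of
  the polynomials or of their iterated derivatives.
*)

theory Submission
  imports Defs
begin

section \<open>Valuations\<close>

locale valued_field =
  fixes \<O> :: "'a::field set"
  assumes valuation_ring: "valuation_ring \<O>"
begin

text \<open>This is |x| <= |y|, expressed as divisibility over the valuation ring. Working with
  elements instead of cosets keeps all estimates inside field arithmetic.\<close>

definition le :: "'a \<Rightarrow> 'a \<Rightarrow> bool" (infix "\<preceq>" 50) where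
  "x \<preceq> y \<longleftrightarrow> (\<exists>z\<in>\<O>. x = z * y)"

definition lt :: "'a \<Rightarrow> 'a \<Rightarrow> bool" (infix "\<prec>" 50) where
  "x \<prec> y \<longleftrightarrow> \<not> y \<preceq> x"

lemma one_in: "1 \<in> \<O>"
  and diff_in: "x \<in> \<O> \<Longrightarrow> y \<in> \<O> \<Longrightarrow> x - y \<in> \<O>"
  and mult_in: "x \<in> \<O> \<Longrightarrow> y \<in> \<O> \<Longrightarrow> x * y \<in> \<O>"
  and inverse_in: "x \<in> \<O> \<or> inverse x \<in> \<O>"
  using valuation_ring by (auto simp: valuation_ring_def)

lemma zero_in: "0 \<in> \<O>"
  using diff_in[OF one_in one_in] by simp

lemma uminus_in: "x \<in> \<O> \<Longrightarrow> - x \<in> \<O>"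
  using diff_in[OF zero_in] by fastforce

lemma add_in: "x \<in> \<O> \<Longrightarrow> y \<in> \<O> \<Longrightarrow> x + y \<in> \<O>"
  using diff_in[OF _ uminus_in] by fastforce

lemma in_iff_le_one: "x \<in> \<O> \<longleftrightarrow> x \<preceq> 1"
  by (simp add: le_def)

lemma le_refl [simp]: "x \<preceq> x"
  unfolding le_def using one_in by force

lemma le_trans [trans]: "x \<preceq> y \<Longrightarrow> y \<preceq> z \<Longrightarrow> x \<preceq> z"
  unfolding le_def by (metis mult.assoc mult_in)

lemma le_zero_iff [simp]: "x \<preceq> 0 \<longleftrightarrow> x = 0"
  unfolding le_def using one_in by auto

lemma zero_le [simp]: "0 \<preceq> x"
  unfolding le_def using zero_in by force

lemma le_linear: "x \<preceq> y \<or> y \<preceq> x"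
proof (cases "x = 0 \<or> y = 0")
  case False
  then show ?thesis
    using inverse_in[of "x / y"] unfolding le_def
    by (metis inverse_divide nonzero_eq_divide_eq)
qed auto

lemma le_mult: "a \<preceq> b \<Longrightarrow> x \<preceq> y \<Longrightarrow> a * x \<preceq> b * y"
  unfolding le_def by (metis mult.assoc mult.left_commute mult_in)

lemma le_power: "a \<preceq> b \<Longrightarrow> a ^ n \<preceq> b ^ n"
  by (induction n) (auto intro: le_mult)

lemma le_add: "x \<preceq> z \<Longrightarrow> y \<preceq> z \<Longrightarrow> x + y \<preceq> z"
  unfolding le_def by (metis add_in distrib_right)

lemma uminus_le_iff [simp]: "- x \<preceq> y \<longleftrightarrow> x \<preceq> y"
  unfolding le_def using uminus_in by (metis add.inverse_inverse mult_minus_left)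

lemma le_uminus_iff [simp]: "x \<preceq> - y \<longleftrightarrow> x \<preceq> y"
  unfolding le_def using uminus_in by (metis minus_mult_minus mult_minus_right add.inverse_inverse)

lemma le_diff: "x \<preceq> z \<Longrightarrow> y \<preceq> z \<Longrightarrow> x - y \<preceq> z"
  using le_add[of x z "- y"] by simp

lemma le_mult_cancel [simp]: "c \<noteq> 0 \<Longrightarrow> c * x \<preceq> c * y \<longleftrightarrow> x \<preceq> y"
  unfolding le_def by (metis mult.left_commute mult_cancel_left)

lemma le_mult_cancel_right [simp]: "c \<noteq> 0 \<Longrightarrow> x * c \<preceq> y * c \<longleftrightarrow> x \<preceq> y"
  using le_mult_cancel by (simp add: mult.commute)

lemma le_sum: "(\<And>i. i \<in> S \<Longrightarrow> f i \<preceq> z) \<Longrightarrow> sum f S \<preceq> z"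
  by (induction S rule: infinite_finite_induct) (auto intro: le_add)

lemma of_nat_le_one: "of_nat n \<preceq> 1"
  by (induction n) (auto intro: le_add)

lemma lt_imp_le: "x \<prec> y \<Longrightarrow> x \<preceq> y"
  unfolding lt_def using le_linear by blast

lemma le_lt_trans [trans]: "x \<preceq> y \<Longrightarrow> y \<prec> z \<Longrightarrow> x \<prec> z"
  unfolding lt_def using le_trans by blast

lemma lt_le_trans [trans]: "x \<prec> y \<Longrightarrow> y \<preceq> z \<Longrightarrow> x \<prec> z"
  unfolding lt_def using le_trans by blast

lemma not_lt_zero [simp]: "\<not> x \<prec> 0"
  by (simp add: lt_def)

lemma zero_lt_iff [simp]: "0 \<prec> x \<longleftrightarrow> x \<noteq> 0"
  by (simp add: lt_def)

lemma uminus_lt_iff [simp]: "- x \<prec> y \<longleftrightarrow> x \<prec> y"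
  by (simp add: lt_def)

lemma lt_mult_cancel [simp]: "c \<noteq> 0 \<Longrightarrow> c * x \<prec> c * y \<longleftrightarrow> x \<prec> y"
  by (simp add: lt_def)

lemma lt_mult_cancel_right [simp]: "c \<noteq> 0 \<Longrightarrow> x * c \<prec> y * c \<longleftrightarrow> x \<prec> y"
  by (simp add: lt_def)

lemma le_lt_mult: "a \<preceq> b \<Longrightarrow> x \<prec> y \<Longrightarrow> b \<noteq> 0 \<Longrightarrow> a * x \<prec> b * y"
  using le_mult[of a b x x] le_lt_trans lt_mult_cancel by (metis le_refl)

lemma lt_le_mult: "a \<prec> b \<Longrightarrow> x \<preceq> y \<Longrightarrow> y \<noteq> 0 \<Longrightarrow> a * x \<prec> b * y"
  using le_lt_mult[of x y a b] by (simp add: mult.commute)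

lemma lt_add: "x \<prec> z \<Longrightarrow> y \<prec> z \<Longrightarrow> x + y \<prec> z"
  using le_linear[of x y] le_add[of x y y] le_add[of x x y] le_lt_trans by (metis le_refl)

lemma lt_diff: "x \<prec> z \<Longrightarrow> y \<prec> z \<Longrightarrow> x - y \<prec> z"
  using lt_add[of x z "- y"] by simp

lemma lt_sum: "(\<And>i. i \<in> S \<Longrightarrow> f i \<prec> z) \<Longrightarrow> z \<noteq> 0 \<Longrightarrow> sum f S \<prec> z"
  by (induction S rule: infinite_finite_induct) (auto intro: lt_add)

text \<open>If the sum had smaller value than \<open>x\<close>, then so would
  \<open>(x + y) - y\<close>, which is \<open>x\<close> itself.\<close>

lemma le_add_lt: "y \<prec> x \<Longrightarrow> x \<preceq> x + y"
  using lt_diff[of "x + y" x y] unfolding lt_def by auto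

lemma ex_nearest:
  assumes "finite C" "C \<noteq> {}"
  obtains c where "c \<in> C" "\<And>z. z \<in> C \<Longrightarrow> f c \<preceq> f z"
proof -
  have "\<exists>c\<in>C. \<forall>z\<in>C. f c \<preceq> f z"
    using assms
  proof (induction rule: finite_ne_induct)
    case (insert x F)
    then obtain c where c: "c \<in> F" "\<forall>z\<in>F. f c \<preceq> f z" by blast
    show ?case
    proof (cases "f c \<preceq> f x")
      case True
      with c show ?thesis by auto
    next
      case False
      then have "f x \<preceq> f c" using le_linear by blast
      with c show ?thesis by (metis insert_iff le_refl le_trans)
    qed
  qed auto
  with that show thesis by blast
qed

section \<open>Values as cosets, translated into the preorder on elements\<close>

lemma val_units_iff: "u \<in> val_units \<O> \<longleftrightarrow> u \<preceq> 1 \<and> 1 \<preceq> u"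
proof -
  have "inverse u \<in> \<O> \<longleftrightarrow> 1 \<preceq> u" if "u \<noteq> 0"
    using le_mult_cancel[OF that, of "inverse u" 1] that by (simp add: in_iff_le_one)
  then show ?thesis
    by (cases "u = 0") (auto simp: val_units_def in_iff_le_one)
qed

lemma val_le_iff: "val_le \<O> (val \<O> x) (val \<O> y) \<longleftrightarrow> x \<preceq> y"
proof
  assume "val_le \<O> (val \<O> x) (val \<O> y)"
  then obtain u v where uv: "u \<in> val_units \<O>" "v \<in> val_units \<O>" "x * u \<preceq> y * v"
    by (auto simp: val_le_def val_def le_def)
  then have "x * 1 \<preceq> x * u" "y * v \<preceq> y * 1"
    by (metis le_mult le_refl val_units_iff)+
  with uv show "x \<preceq> y"
    by (metis le_trans mult.right_neutral)
next
  assume "x \<preceq> y"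
  moreover have "z \<in> val \<O> z" for z
    unfolding val_def using val_units_iff[of 1] by force
  ultimately show "val_le \<O> (val \<O> x) (val \<O> y)"
    unfolding val_le_def le_def by blast
qed

lemma val_eq_iff: "val \<O> x = val \<O> y \<longleftrightarrow> x \<preceq> y \<and> y \<preceq> x"
proof
  assume "val \<O> x = val \<O> y"
  then show "x \<preceq> y \<and> y \<preceq> x"
    by (metis le_refl val_le_iff)
next
  have sub: "val \<O> x \<subseteq> val \<O> y" if xy: "x \<preceq> y" "y \<preceq> x" for x y
  proof
    fix w assume "w \<in> val \<O> x"
    then obtain u where u: "w = x * u" "u \<in> val_units \<O>"
      by (auto simp: val_def)
    show "w \<in> val \<O> y"
    proof (cases "y = 0")
      case True
      with xy u have "w = y * u" by simp
      then show ?thesis using u(2) by (auto simp: val_def)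
    next
      case False
      have "w \<preceq> y * 1" "y * 1 \<preceq> w"
        unfolding u using xy u(2) by (auto intro: le_mult simp: val_units_iff simp del: mult_1_right)
      then have "y * (w / y) \<preceq> y * 1" "y * 1 \<preceq> y * (w / y)"
        using False by simp_all
      then have "w / y \<in> val_units \<O>"
        unfolding val_units_iff using False le_mult_cancel by blast
      moreover have "w = y * (w / y)"
        using False by simp
      ultimately show ?thesis
        unfolding val_def by blast
    qed
  qed
  assume "x \<preceq> y \<and> y \<preceq> x"
  with sub show "val \<O> x = val \<O> y" by blast
qed

lemma val_less_iff: "val_less \<O> (val \<O> x) (val \<O> y) \<longleftrightarrow> x \<prec> y"
  using le_linear[of x y] by (auto simp: val_less_def val_le_iff val_eq_iff lt_def)

lemma val_maximal_ideal_iff_lt: "x \<in> val_maximal_ideal \<O> \<longleftrightarrow> x \<prec> 1"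
  by (simp add: val_maximal_ideal_def val_less_iff)

lemma val_in_values_le_one_iff: "val \<O> k \<in> values_le_one \<O> \<longleftrightarrow> k \<noteq> 0 \<and> k \<preceq> 1"
  by (auto simp: values_le_one_def value_group_def val_le_iff val_eq_iff intro!: exI[of _ k])

lemma values_le_oneE:
  assumes "lam \<in> values_le_one \<O>"
  obtains k where "lam = val \<O> k" "k \<noteq> 0" "k \<preceq> 1"
  using assms val_in_values_le_one_iff
  by (auto simp: values_le_one_def value_group_def val_le_iff)

section \<open>Leading terms at the level of an element k\<close>

lemma rv_alt: "rv \<O> (val \<O> k) x = {x * (1 + y) |y. y \<prec> k}"
  by (simp add: rv_def val_less_iff)

text \<open>The elements \<open>1 + y\<close> with |y| < |k| are closed under multiplication,
  because |k| <= 1 bounds the cross term \<open>y * z\<close>.\<close>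

lemma rv_mult_subset:
  assumes "y \<prec> k" "k \<preceq> 1"
  shows "rv \<O> (val \<O> k) (x * (1 + y)) \<subseteq> rv \<O> (val \<O> k) x"
proof -
  have "\<exists>w. x * (1 + y) * (1 + z) = x * (1 + w) \<and> w \<prec> k" if "z \<prec> k" for z
  proof (intro exI conjI)
    show "x * (1 + y) * (1 + z) = x * (1 + (y + z + y * z))"
      by (simp add: algebra_simps)
    have "z \<preceq> 1"
      using that assms le_trans lt_imp_le by blast
    then have "y * z \<prec> k * 1"
      using assms(1) by (intro lt_le_mult) auto
    then show "y + z + y * z \<prec> k"
      using assms(1) that by (intro lt_add) auto
  qed
  then show ?thesis
    unfolding rv_alt by blast
qed

text \<open>This is the working form of equality of leading terms. The disjunct
  \<open>x = x'\<close> serves the point 0, where the strict inequality fails.\<close>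

lemma rv_eq_iff:
  assumes k: "k \<noteq> 0" "k \<preceq> 1"
  shows "rv \<O> (val \<O> k) x = rv \<O> (val \<O> k) x' \<longleftrightarrow> x = x' \<or> x - x' \<prec> k * x"
proof
  assume eq: "rv \<O> (val \<O> k) x = rv \<O> (val \<O> k) x'"
  have "x' \<in> rv \<O> (val \<O> k) x'"
    unfolding rv_alt using k(1) by (intro CollectI exI[of _ 0]) auto
  then have "x' \<in> rv \<O> (val \<O> k) x"
    using eq by simp
  then obtain y where y: "x' = x * (1 + y)" "y \<prec> k"
    unfolding rv_alt by blast
  have "x - x' \<prec> k * x" if "x \<noteq> 0"
  proof -
    have "x - x' = - (y * x)"
      by (simp add: y algebra_simps)
    then show ?thesis
      using y(2) that by simp
  qed
  moreover have "x = x'" if "x = 0"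
    using y that by simp
  ultimately show "x = x' \<or> x - x' \<prec> k * x" by blast
next
  assume "x = x' \<or> x - x' \<prec> k * x"
  then show "rv \<O> (val \<O> k) x = rv \<O> (val \<O> k) x'"
  proof
    assume lt: "x - x' \<prec> k * x"
    then have x: "x \<noteq> 0" by auto
    define y where "y = (x' - x) / x"
    have x': "x' = x * (1 + y)"
      using x by (simp add: y_def field_simps)
    have "x - x' = - (x * y)"
      by (simp add: x' algebra_simps)
    with lt have "x * y \<prec> x * k"
      by (simp add: mult.commute)
    then have yk: "y \<prec> k"
      using x by simp
    then have y1: "1 \<preceq> 1 + y"
      using k le_add_lt[of y 1] lt_le_trans by blast
    \<comment> \<open>\<open>1 + z\<close> is the inverse of \<open>1 + y\<close>, so the inclusion
      of cosets can be used in both directions.\<close>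
    define z where "z = - y / (1 + y)"
    have n0: "1 + y \<noteq> 0"
      using y1 by auto
    have "(1 + y) * z \<prec> (1 + y) * k"
      using yk n0 le_mult[OF y1 le_refl, of k] by (auto simp: z_def intro: lt_le_trans)
    then have zk: "z \<prec> k"
      using n0 by simp
    have "x = x' * (1 + z)"
      using n0 by (simp add: x' z_def field_simps)
    then show ?thesis
      using rv_mult_subset[OF yk k(2), of x] rv_mult_subset[OF zk k(2), of x'] x' by (metis subset_antisym)
  qed auto
qed

lemma rv_eq_zero_iff:
  assumes "k \<noteq> 0" "k \<preceq> 1"
  shows "rv \<O> (val \<O> k) x = rv \<O> (val \<O> k) 0 \<longleftrightarrow> x = 0"
  using rv_eq_iff[OF assms, of 0 x] by auto

lemma rv_zero: "k \<noteq> 0 \<Longrightarrow> rv \<O> (val \<O> k) 0 = {0}"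
  by (auto simp: rv_alt intro!: exI[of _ 0])

lemma rv_eq_imp_le:
  assumes k: "k \<noteq> 0" "k \<preceq> 1" and eq: "rv \<O> (val \<O> k) x = rv \<O> (val \<O> k) x'"
  shows "x \<preceq> x'"
proof -
  have "x' = x \<or> x' - x \<prec> k * x'"
    using eq rv_eq_iff[OF k] by metis
  then show ?thesis
  proof
    assume "x' - x \<prec> k * x'"
    moreover have "k * x' \<preceq> 1 * x'"
      using k by (intro le_mult) auto
    ultimately have "x' - x \<preceq> x'"
      by (metis le_trans lt_imp_le mult_1)
    then show ?thesis
      using le_diff[of x' x' "x' - x"] by simp
  qed auto
qed

lemma rv_mult:
  assumes k: "k \<noteq> 0" "k \<preceq> 1"
    and "rv \<O> (val \<O> k) x = rv \<O> (val \<O> k) x'" "rv \<O> (val \<O> k) y = rv \<O> (val \<O> k) y'"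
  shows "rv \<O> (val \<O> k) (x * y) = rv \<O> (val \<O> k) (x' * y')"
proof -
  have left: "rv \<O> (val \<O> k) (z * x) = rv \<O> (val \<O> k) (z * x')"
    if "rv \<O> (val \<O> k) x = rv \<O> (val \<O> k) x'" for x x' z
  proof (cases "z = 0")
    case False
    have "z * x - z * x' = z * (x - x')" "k * (z * x) = z * (k * x)"
      by (simp_all add: algebra_simps)
    then have "z * x - z * x' \<prec> k * (z * x) \<longleftrightarrow> x - x' \<prec> k * x"
      using False by (simp only: lt_mult_cancel not_False_eq_True)
    with that show ?thesis
      unfolding rv_eq_iff[OF k] by auto
  qed simp
  show ?thesis
    using left[OF assms(3), of y] left[OF assms(4), of x'] by (simp add: mult.commute)
qed

lemma rv_power:
  assumes k: "k \<noteq> 0" "k \<preceq> 1" and "rv \<O> (val \<O> k) x = rv \<O> (val \<O> k) x'"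
  shows "rv \<O> (val \<O> k) (x ^ n) = rv \<O> (val \<O> k) (x' ^ n)"
proof (induction n)
  case (Suc n)
  then show ?case
    using rv_mult[OF k assms(3)] by simp
qed simp

text \<open>This removes factorials from Taylor coefficients and powers of leading coefficients from
  pseudo-remainders.\<close>

lemma rv_mult_cancel:
  assumes k: "k \<noteq> 0" "k \<preceq> 1" and "a \<noteq> 0"
    and a: "rv \<O> (val \<O> k) a = rv \<O> (val \<O> k) a'"
    and eq: "rv \<O> (val \<O> k) (a * x) = rv \<O> (val \<O> k) (a' * x')"
  shows "rv \<O> (val \<O> k) x = rv \<O> (val \<O> k) x'"
proof -
  have "rv \<O> (val \<O> k) (a * x') = rv \<O> (val \<O> k) (a * x)"
    using rv_mult[OF k a refl] eq by metis
  then have "rv \<O> (val \<O> k) (inverse a * (a * x')) = rv \<O> (val \<O> k) (inverse a * (a * x))"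
    by (rule rv_mult[OF k refl])
  moreover have "inverse a * (a * z) = z" for z
    using \<open>a \<noteq> 0\<close> by (simp flip: mult.assoc)
  ultimately show ?thesis by simp
qed

text \<open>A smaller level gives finer cosets. Hence parameters of level 1 can be handled together
  with those of level \<open>k\<close>.\<close>

lemma rv_coarsen:
  assumes k: "k \<noteq> 0" "k \<preceq> k'" "k' \<preceq> 1"
    and eq: "rv \<O> (val \<O> k) x = rv \<O> (val \<O> k) x'"
  shows "rv \<O> (val \<O> k') x = rv \<O> (val \<O> k') x'"
proof -
  have k': "k' \<noteq> 0" and k1: "k \<preceq> 1"
    using k le_trans by auto
  have "k * x \<preceq> k' * x"
    using k by (intro le_mult) auto
  then show ?thesis
    using eq lt_le_trans unfolding rv_eq_iff[OF k(1) k1] rv_eq_iff[OF k' k(3)] by blast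
qed

text \<open>Leading terms are bare sets, so it has to be shown that a nonzero one remembers its
  level: for |k'| < |k| the coset of \<open>x\<close> at level \<open>k'\<close> omits
  \<open>x * (1 + k')\<close>, and the one at level \<open>k\<close> contains it.\<close>

lemma rv_eq_imp_level_le:
  assumes k: "k \<noteq> 0" "k \<preceq> 1" and k': "k' \<noteq> 0" "k' \<preceq> 1" and "x \<noteq> 0"
    and eq: "rv \<O> (val \<O> k) x = rv \<O> (val \<O> k') x'"
  shows "k \<preceq> k'"
proof (rule ccontr)
  assume "\<not> k \<preceq> k'"
  then have "k' \<prec> k"
    by (simp add: lt_def)
  have "x \<in> rv \<O> (val \<O> k) x"
    unfolding rv_alt using k(1) by (intro CollectI exI[of _ 0]) auto
  with eq obtain y where y: "x = x' * (1 + y)" "y \<prec> k'"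
    by (auto simp: rv_alt)
  have "x' - x = - (y * x')"
    by (simp add: y algebra_simps)
  moreover have "x' \<noteq> 0"
    using y \<open>x \<noteq> 0\<close> by auto
  ultimately have "rv \<O> (val \<O> k') x = rv \<O> (val \<O> k') x'"
    using y(2) rv_eq_iff[OF k', of x' x] by simp
  with eq have "x * (1 + k') \<in> rv \<O> (val \<O> k') x"
    using \<open>k' \<prec> k\<close> by (auto simp: rv_alt)
  then obtain z where "x * (1 + k') = x * (1 + z)" "z \<prec> k'"
    by (auto simp: rv_alt)
  with \<open>x \<noteq> 0\<close> show False
    by (auto simp: lt_def)
qed

end


section \<open>Taylor expansions\<close>

text \<open>This is q(c + X); its coefficients are the Taylor coefficients of \<open>q\<close> at
  \<open>c\<close>.\<close>

definition shift :: "'a::field \<Rightarrow> 'a poly \<Rightarrow> 'a poly" where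
  "shift c q = pcompose q [:c, 1:]"

lemma poly_shift [simp]: "poly (shift c q) u = poly q (c + u)"
  by (simp add: shift_def poly_pcompose)

lemma shift_shift: "shift u (shift c q) = shift (c + u) q"
proof -
  have "pcompose [:c, 1:] [:u, 1:] = [:c + u, 1:]"
    by (simp add: pcompose_pCons)
  then show ?thesis
    by (simp add: shift_def flip: pcompose_assoc)
qed

lemma shift_pCons: "shift c (pCons a q) = [:a:] + smult c (shift c q) + pCons 0 (shift c q)"
  by (simp add: shift_def pcompose_pCons)

lemma degree_shift [simp]: "degree (shift c q) = degree q"
  by (simp add: shift_def degree_pcompose)

lemma coeff_shift_0: "coeff (shift c q) 0 = poly q c"
  using poly_shift[of c q 0] by (simp add: poly_0_coeff_0)

lemma pderiv_shift: "pderiv (shift c q) = shift c (pderiv q)"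
  by (simp add: shift_def pderiv_pcompose pderiv_pCons)

lemma coeff_shift_pderiv:
  "of_nat (Suc k) * coeff (shift c q) (Suc k) = coeff (shift c (pderiv q)) k"
  by (simp add: coeff_pderiv flip: pderiv_shift)

lemma higher_pderiv_shift:
  "(pderiv ^^ k) (shift c q) = shift c ((pderiv ^^ k) q)"
  by (induction k) (auto simp: pderiv_shift)

lemma coeff_0_higher_pderiv:
  "coeff ((pderiv ^^ k) (q :: 'a::field poly)) 0 = of_nat (fact k) * coeff q k"
proof -
  \<comment> \<open>Generalised to every coefficient, since differentiation moves the index by
    one.\<close>
  have "of_nat (fact n) * coeff ((pderiv ^^ k) q) n = of_nat (fact (n + k)) * coeff q (n + k)"
    for n
  proof (induction k arbitrary: n)
    case (Suc k)
    have "of_nat (fact (Suc n)) = (of_nat (fact n) * of_nat (Suc n) :: 'a)"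
      by (simp only: fact_Suc of_nat_mult of_nat_id mult.commute)
    then have "of_nat (fact n) * coeff ((pderiv ^^ Suc k) q) n =
        of_nat (fact (Suc n)) * coeff ((pderiv ^^ k) q) (Suc n)"
      by (simp only: coeff_pderiv funpow.simps comp_apply mult.assoc)
    then show ?case
      using Suc.IH[of "Suc n"] by simp
  qed simp
  from this[of 0] show ?thesis by simp
qed

text \<open>Taylor's formula with the factorials multiplied out, so that no division occurs.\<close>

lemma fact_mult_coeff_shift:
  "of_nat (fact k) * coeff (shift c q) k = poly ((pderiv ^^ k) q) c"
  by (metis coeff_0_higher_pderiv coeff_shift_0 higher_pderiv_shift)

lemma degree_pderiv_le_diff: "degree (pderiv q) \<le> degree q - 1" for q :: "'a::field poly"
  by (rule degree_le) (auto simp: coeff_pderiv intro!: disjI2 coeff_eq_0)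

lemma higher_pderiv_eq_0:
  "degree (q :: 'a::field poly) < k \<Longrightarrow> (pderiv ^^ k) q = 0"
proof (induction k arbitrary: q)
  case (Suc k)
  show ?case
  proof (cases "degree q = 0")
    case True
    then have "pderiv q = 0"
      by (intro poly_eqI) (simp add: coeff_pderiv coeff_eq_0)
    moreover have "(pderiv ^^ k) (0 :: 'a poly) = 0"
      by (induction k) auto
    ultimately show ?thesis
      by (simp add: funpow_swap1)
  next
    case False
    then have "degree (pderiv q) < k"
      using Suc.prems degree_pderiv_le_diff[of q] by linarith
    then show ?thesis
      using Suc.IH[of "pderiv q"] by (simp add: funpow_swap1)
  qed
qed simp

text \<open>Moving the center by at most the radius |u| does not increase the Gauss norm of that
  radius. The induction follows Horner's scheme: the tail of \<open>pCons a r\<close> satisfies the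
  bound \<open>M / u\<close>.\<close>

lemma (in valued_field) coeff_shift_le:
  assumes "u \<noteq> 0" "w \<preceq> u" "\<And>j. coeff r j * u ^ j \<preceq> M"
  shows "coeff (shift w r) k * u ^ k \<preceq> M"
  using assms(3)
proof (induction r arbitrary: M k)
  case 0
  then show ?case by (simp add: shift_def)
next
  case (pCons a r)
  have a: "a \<preceq> M"
    using pCons.prems[of 0] by simp
  have r: "coeff r j * u ^ j \<preceq> M / u" for j
  proof -
    have "u * (coeff r j * u ^ j) \<preceq> u * (M / u)"
      using pCons.prems[of "Suc j"] assms(1) by (simp add: mult_ac)
    then show ?thesis
      using assms(1) le_mult_cancel by blast
  qed
  have IH: "coeff (shift w r) j * u ^ j \<preceq> M / u" for j
    using pCons.IH r by blast
  have 1: "w * (coeff (shift w r) j * u ^ j) \<preceq> M" for j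
    using le_mult[OF assms(2) IH[of j]] assms(1) by simp
  have 2: "u * (coeff (shift w r) j * u ^ j) \<preceq> M" for j
    using le_mult[OF le_refl IH[of j], of u] assms(1) by simp
  show ?case
  proof (cases k)
    case 0
    then show ?thesis
      using a 1[of 0] by (simp add: shift_pCons le_add)
  next
    case (Suc j)
    have "coeff (shift w (pCons a r)) k * u ^ k =
        w * (coeff (shift w r) k * u ^ k) + u * (coeff (shift w r) j * u ^ j)"
      by (simp add: shift_pCons Suc algebra_simps)
    then show ?thesis
      using le_add[OF 1[of k] 2[of j]] by simp
  qed
qed


section \<open>Hensel's lemma and polynomials without nearby roots\<close>

text \<open>As |n| <= 1 always holds, the first assumption makes positive integers units. This is
  residue characteristic 0 and lets integer factors be ignored in estimates.\<close>

locale henselian_field = valued_field +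
  assumes one_le_of_nat: "n > 0 \<Longrightarrow> 1 \<preceq> of_nat n"
    and hensel: "henselian \<O>"
begin

lemma of_nat_neq_0: "n > 0 \<Longrightarrow> of_nat n \<noteq> (0 :: 'a)"
  using one_le_of_nat[of n] by auto

lemma of_nat_mult_le_iff:
  assumes "n > 0"
  shows "of_nat n * x \<preceq> y \<longleftrightarrow> x \<preceq> y"
proof -
  have "of_nat n * x \<preceq> 1 * x"
    by (intro le_mult of_nat_le_one le_refl)
  moreover have "1 * x \<preceq> of_nat n * x"
    by (intro le_mult one_le_of_nat assms le_refl)
  ultimately show ?thesis
    using le_trans[of "of_nat n * x" x y] le_trans[of x "of_nat n * x" y] unfolding mult_1_left
    by blast
qed

text \<open>Newton form of Hensel's lemma. Scaling the variable by the quotient \<open>w\<close> of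
  the two lowest coefficients turns \<open>r\<close> into a multiple of 1 + s + (terms with small
  coefficients), which has the approximate root -1.\<close>

lemma hensel_root:
  assumes u: "u \<noteq> 0" and coeffs: "\<And>k. k \<ge> 2 \<Longrightarrow> coeff r k * u ^ k \<preceq> coeff r 1 * u"
    and const: "coeff r 0 \<prec> coeff r 1 * u"
  obtains v where "poly r v = 0" "coeff r 1 * v \<preceq> coeff r 0" "v \<prec> u"
proof (cases "coeff r 0 = 0")
  case True
  then have "poly r 0 = 0"
    by (simp only: poly_0_coeff_0)
  then show ?thesis
    using u that[of 0] by simp
next
  case False
  define a0 a1 where "a0 = coeff r 0" and "a1 = coeff r 1"
  define w where "w = a0 / a1"
  have a0: "a0 \<noteq> 0" and a1: "a1 \<noteq> 0"
    using False const by (auto simp: a0_def a1_def)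
  have w: "a1 * w = a0"
    using a1 by (simp add: w_def)
  then have "a1 * w \<prec> a1 * u"
    using const by (simp add: a0_def a1_def)
  then have wu: "w \<prec> u"
    using a1 by simp
  define f where "f = smult (inverse a0) (pcompose r [:0, w:])"
  have coeff_f: "coeff f k = coeff r k * w ^ k / a0" for k
    by (simp add: f_def coeff_pcompose_linear field_simps)
  have poly_f: "poly f s = poly r (w * s) / a0" for s
    by (simp add: f_def poly_pcompose field_simps)
  have f0: "coeff f 0 = 1"
    using a0 by (simp add: coeff_f a0_def)
  have f1: "coeff f 1 = 1"
    using a0 w by (simp add: coeff_f a1_def)
  \<comment> \<open>By the bound at radius |u|, this coefficient has value at most |w / u| to the
    power k - 1, and |w| < |u|.\<close>
  have f2: "coeff f k \<prec> 1" if "k \<ge> 2" for k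
  proof -
    define j where "j = k - 2"
    have j: "k = Suc (Suc j)"
      using that by (simp add: j_def)
    have "coeff r k * u ^ k \<preceq> a1 * u"
      using coeffs[OF that] by (simp add: a1_def)
    then have "coeff r k * u ^ k * (w / u) ^ k \<preceq> a1 * u * (w / u) ^ k"
      by (rule le_mult[OF _ le_refl])
    also have "coeff r k * u ^ k * (w / u) ^ k = coeff r k * w ^ k"
      using u by (simp add: power_divide)
    also have "a1 * u * (w / u) ^ k = (a1 * w) * (w / u) ^ Suc j"
      using u by (simp add: j)
    also have "\<dots> = a0 * ((w / u) ^ j * (w / u))"
      by (simp add: w mult.commute)
    finally have le: "a0 * coeff f k \<preceq> a0 * ((w / u) ^ j * (w / u))"
      using a0 by (simp add: coeff_f)
    have "u * (w / u) \<prec> u * 1"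
      using wu u by simp
    then have lt: "w / u \<prec> 1"
      using lt_mult_cancel[OF u] by blast
    then have "(w / u) ^ j \<preceq> 1 ^ j"
      by (intro le_power lt_imp_le)
    then have "(w / u) ^ j * (w / u) \<prec> 1 * 1"
      using lt by (intro le_lt_mult) auto
    moreover have "coeff f k \<preceq> (w / u) ^ j * (w / u)"
      using le le_mult_cancel[OF a0] by blast
    ultimately show ?thesis
      using le_lt_trans by simp
  qed
  obtain b0 h where "f = pCons b0 h"
    by (cases f)
  moreover obtain b1 g where "h = pCons b1 g"
    by (cases h)
  ultimately have g: "f = pCons 1 (pCons 1 g)"
    using f0 f1 by simp
  have coeff_g: "coeff g k \<prec> 1" for k
    using f2[of "Suc (Suc k)"] by (simp add: g)
  have poly_lt: "poly h s \<prec> 1" if "\<And>k. coeff h k \<prec> 1" "s \<preceq> 1" for h s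
    unfolding poly_altdef
  proof (rule lt_sum)
    fix i
    have "s ^ i \<preceq> 1 ^ i"
      using that(2) by (rule le_power)
    then have "coeff h i * s ^ i \<prec> 1 * 1"
      using that(1) by (intro lt_le_mult) auto
    then show "coeff h i * s ^ i \<prec> 1" by simp
  qed auto
  have coeff_pderiv_g: "coeff (pderiv g) k \<prec> 1" for k
  proof -
    have "of_nat (Suc k) * coeff g (Suc k) \<prec> 1 * 1"
      by (rule le_lt_mult[OF of_nat_le_one coeff_g]) auto
    then show ?thesis by (simp add: coeff_pderiv)
  qed
  have "coeff f i \<in> \<O>" for i
    using coeff_g lt_imp_le by (auto simp: g coeff_pCons in_iff_le_one split: nat.split)
  moreover have "- 1 \<in> \<O>"
    by (simp add: in_iff_le_one)
  moreover have "poly f (- 1) \<in> val_maximal_ideal \<O>"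
    using poly_lt[OF coeff_g, of "- 1"] by (simp add: g val_maximal_ideal_iff_lt)
  \<comment> \<open>Writing f = 1 + s + s^2 g, the derivative at -1 is 1 + g'(-1) - 2 g(-1), a unit
    because the coefficients of \<open>g\<close> are small.\<close>
  moreover have "poly (pderiv f) (- 1) \<notin> val_maximal_ideal \<O>"
  proof -
    have "poly (pderiv g) (- 1) - 2 * poly g (- 1) \<prec> 1"
    proof (rule lt_diff)
      have "of_nat 2 * poly g (- 1) \<prec> 1 * 1"
        using poly_lt[OF coeff_g, of "- 1"] by (intro le_lt_mult of_nat_le_one) auto
      then show "2 * poly g (- 1) \<prec> 1" by simp
    qed (use poly_lt[OF coeff_pderiv_g, of "- 1"] in simp)
    then have "1 \<preceq> 1 + (poly (pderiv g) (- 1) - 2 * poly g (- 1))"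
      by (rule le_add_lt)
    moreover have "poly (pderiv f) (- 1) = 1 + (poly (pderiv g) (- 1) - 2 * poly g (- 1))"
      by (simp add: g pderiv_pCons algebra_simps)
    ultimately show ?thesis
      by (simp add: val_maximal_ideal_iff_lt lt_def)
  qed
  ultimately obtain b where b: "b \<in> \<O>" "poly f b = 0"
    using hensel[unfolded henselian_def, rule_format, of "- 1" f] by blast
  have bw: "w * b \<preceq> w * 1"
    using b(1) by (intro le_mult) (auto simp: in_iff_le_one)
  show ?thesis
  proof (rule that[of "w * b"])
    show "poly r (w * b) = 0"
      using b(2) a0 by (simp add: poly_f)
    have "a1 * (w * b) \<preceq> a1 * (w * 1)"
      by (rule le_mult[OF le_refl bw])
    then show "coeff r 1 * (w * b) \<preceq> coeff r 0"
      using w by (simp add: a0_def a1_def)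
    show "w * b \<prec> u"
      using bw wu le_lt_trans by simp
  qed
qed

text \<open>Induction on the degree through the derivative, whose bound shows that the linear term
  bounds all terms of positive degree at radius |u|. The constant term is at least as large as the
  linear one, since otherwise \<open>hensel_root\<close> gives a root closer to \<open>y\<close>
  than |u|.\<close>

lemma taylor_coeff_le_of_no_near_root:
  assumes u: "u \<noteq> 0"
    and no_root: "\<And>j z. (pderiv ^^ j) q \<noteq> 0 \<Longrightarrow> poly ((pderiv ^^ j) q) z = 0 \<Longrightarrow> u \<preceq> z - y"
  shows "coeff (shift y q) k * u ^ k \<preceq> poly q y"
  using no_root
proof (induction "degree q" arbitrary: q k rule: less_induct)
  case less
  show ?case
  proof (cases "degree q = 0")
    case True
    then show ?thesis
      by (cases k) (auto simp: coeff_shift_0 coeff_eq_0)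
  next
    case False
    let ?a = "coeff (shift y q) 1"
    have "degree (pderiv q) < degree q"
      using False degree_pderiv_le_diff[of q] by linarith
    moreover have "u \<preceq> z - y"
      if "(pderiv ^^ j) (pderiv q) \<noteq> 0" "poly ((pderiv ^^ j) (pderiv q)) z = 0" for j z
      using less.prems[of "Suc j" z] that by (simp add: funpow_swap1)
    ultimately have IH: "coeff (shift y (pderiv q)) j * u ^ j \<preceq> poly (pderiv q) y" for j
      using less.hyps by blast
    have a: "poly (pderiv q) y = ?a"
      using coeff_shift_pderiv[of 0 y q] by (simp add: coeff_shift_0)
    have a1: "coeff (shift y q) (Suc j) * u ^ Suc j \<preceq> ?a * u" for j
    proof -
      have "of_nat (Suc j) * coeff (shift y q) (Suc j) * u ^ j \<preceq> ?a"
        using IH[of j] by (simp only: coeff_shift_pderiv a)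
      then have "of_nat (Suc j) * (coeff (shift y q) (Suc j) * u ^ j) \<preceq> ?a"
        by (simp only: mult.assoc)
      then have "coeff (shift y q) (Suc j) * u ^ j \<preceq> ?a"
        using of_nat_mult_le_iff by blast
      then have "coeff (shift y q) (Suc j) * u ^ j * u \<preceq> ?a * u"
        by (rule le_mult[OF _ le_refl])
      then show ?thesis by (simp add: mult_ac)
    qed
    have a0: "?a * u \<preceq> poly q y"
    proof (rule ccontr)
      assume "\<not> ?a * u \<preceq> poly q y"
      then have lt: "coeff (shift y q) 0 \<prec> ?a * u"
        by (simp add: lt_def coeff_shift_0)
      have "coeff (shift y q) j * u ^ j \<preceq> ?a * u" if "j \<ge> 2" for j
        using a1[of "j - 1"] that by simp
      then obtain v where v: "poly (shift y q) v = 0" "v \<prec> u"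
        using hensel_root[OF u _ lt] by blast
      moreover have "q \<noteq> 0"
        using False by auto
      ultimately have "u \<preceq> y + v - y"
        using less.prems[of 0 "y + v"] by simp
      with v show False
        by (simp add: lt_def)
    qed
    show ?thesis
      using le_trans[OF a1 a0] by (cases k) (auto simp: coeff_shift_0)
  qed
qed

text \<open>The distance from \<open>y\<close> to \<open>c\<close> serves as radius, and recentering
  from \<open>y\<close> to \<open>c\<close> is a move of exactly that size.\<close>

lemma taylor_coeff_le_of_nearest:
  assumes "\<And>j z. (pderiv ^^ j) q \<noteq> 0 \<Longrightarrow> poly ((pderiv ^^ j) q) z = 0 \<Longrightarrow> y - c \<preceq> z - y"
  shows "coeff (shift c q) k * (y - c) ^ k \<preceq> poly q y"
proof (cases "y = c")
  case True
  then show ?thesis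
    by (cases k) (auto simp: coeff_shift_0)
next
  case False
  then have "coeff (shift y q) j * (y - c) ^ j \<preceq> poly q y" for j
    using taylor_coeff_le_of_no_near_root assms by simp
  moreover have "shift (c - y) (shift y q) = shift c q"
    by (simp add: shift_shift)
  moreover have "c - y \<preceq> y - c"
    by (metis le_refl minus_diff_eq uminus_le_iff)
  ultimately show ?thesis
    using coeff_shift_le[of "y - c" "c - y" "shift y q" "poly q y" k] False by simp
qed

end

section \<open>Evaluating polynomials on leading terms\<close>

lemma (in valued_field) rv_poly_cong:
  assumes k: "k \<noteq> 0" "k \<preceq> 1"
    and coeffs: "\<And>j. rv \<O> (val \<O> k) (coeff t j) = rv \<O> (val \<O> k) (coeff t' j)"
    and u: "rv \<O> (val \<O> k) u = rv \<O> (val \<O> k) u'"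
    and dominated: "\<And>j. coeff t j * u ^ j \<preceq> M" and "M \<noteq> 0"
  shows "poly t u - poly t' u' \<prec> k * M"
proof -
  define n where "n = max (degree t) (degree t')"
  have sum: "poly t x = (\<Sum>j\<le>n. coeff t j * x ^ j)" "poly t' x = (\<Sum>j\<le>n. coeff t' j * x ^ j)" for x
    unfolding poly_altdef n_def by (auto intro!: sum.mono_neutral_left intro: le_degree)
  have kM: "k * M \<noteq> 0"
    using k \<open>M \<noteq> 0\<close> by simp
  \<comment> \<open>Corresponding terms have equal leading terms, so they are equal or differ by
    less than |k| times their own value.\<close>
  have "coeff t j * u ^ j - coeff t' j * u' ^ j \<prec> k * M" for j
  proof -
    have "rv \<O> (val \<O> k) (coeff t j * u ^ j) = rv \<O> (val \<O> k) (coeff t' j * u' ^ j)"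
      by (intro rv_mult[OF k] rv_power[OF k] coeffs u)
    then consider "coeff t j * u ^ j = coeff t' j * u' ^ j"
      | "coeff t j * u ^ j - coeff t' j * u' ^ j \<prec> k * (coeff t j * u ^ j)"
      unfolding rv_eq_iff[OF k] by blast
    then show ?thesis
    proof cases
      case 2
      also have "k * (coeff t j * u ^ j) \<preceq> k * M"
        by (rule le_mult[OF le_refl dominated])
      finally show ?thesis .
    qed (use kM in simp)
  qed
  then have "(\<Sum>j\<le>n. coeff t j * u ^ j - coeff t' j * u' ^ j) \<prec> k * M"
    using kM by (intro lt_sum) auto
  then show ?thesis
    by (simp add: sum sum_subtractf)
qed

text \<open>Without cancellation the value of the polynomial can serve as the bound
  \<open>M\<close>, so the error is relative to the value itself. If that value is 0, every term
  vanishes, and so does every matching term.\<close>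

lemma (in valued_field) rv_poly_cong_of_dominated:
  assumes k: "k \<noteq> 0" "k \<preceq> 1"
    and coeffs: "\<And>j. rv \<O> (val \<O> k) (coeff t j) = rv \<O> (val \<O> k) (coeff t' j)"
    and u: "rv \<O> (val \<O> k) u = rv \<O> (val \<O> k) u'"
    and dominated: "\<And>j. coeff t j * u ^ j \<preceq> poly t u"
  shows "rv \<O> (val \<O> k) (poly t u) = rv \<O> (val \<O> k) (poly t' u')"
proof (cases "poly t u = 0")
  case True
  have "coeff t' j * u' ^ j = 0" for j
  proof -
    have "rv \<O> (val \<O> k) (coeff t j * u ^ j) = rv \<O> (val \<O> k) (coeff t' j * u' ^ j)"
      by (intro rv_mult[OF k] rv_power[OF k] coeffs u)
    then show ?thesis
      using dominated[of j] True rv_eq_zero_iff[OF k] by (metis le_zero_iff)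
  qed
  then have "poly t' u' = 0"
    unfolding poly_altdef by (intro sum.neutral) simp
  with True show ?thesis by simp
next
  case False
  then show ?thesis
    using rv_poly_cong[OF k coeffs u dominated] by (simp add: rv_eq_iff[OF k])
qed


section \<open>Polynomial functions of an environment\<close>

text \<open>Polynomials over the ring generated by \<open>A\<close>, taken as functions on
  environments. Closure under differences also yields 0 and negatives.\<close>

inductive_set pol_funs :: "'a::field set \<Rightarrow> ((nat \<Rightarrow> 'a) \<Rightarrow> 'a) set" for A where
  var: "(\<lambda>e. e i) \<in> pol_funs A"
| const: "a \<in> A \<Longrightarrow> (\<lambda>_. a) \<in> pol_funs A"
| one: "(\<lambda>_. 1) \<in> pol_funs A"
| diff: "f \<in> pol_funs A \<Longrightarrow> g \<in> pol_funs A \<Longrightarrow> (\<lambda>e. f e - g e) \<in> pol_funs A"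
| mult: "f \<in> pol_funs A \<Longrightarrow> g \<in> pol_funs A \<Longrightarrow> (\<lambda>e. f e * g e) \<in> pol_funs A"

lemma pol_funs_zero: "(\<lambda>_. 0) \<in> pol_funs A"
  using pol_funs.diff[OF pol_funs.one pol_funs.one] by simp

lemma pol_funs_add:
  assumes "f \<in> pol_funs A" "g \<in> pol_funs A"
  shows "(\<lambda>e. f e + g e) \<in> pol_funs A"
  using pol_funs.diff[OF assms(1) pol_funs.diff[OF pol_funs_zero assms(2)]] by simp

lemma pol_funs_of_nat: "(\<lambda>_. of_nat n) \<in> pol_funs A"
  by (induction n) (auto intro: pol_funs_zero pol_funs_add pol_funs.one)

lemma pol_funs_sum:
  "(\<And>i. i \<in> S \<Longrightarrow> f i \<in> pol_funs A) \<Longrightarrow> (\<lambda>e. \<Sum>i\<in>S. f i e) \<in> pol_funs A"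
  by (induction S rule: infinite_finite_induct) (auto intro: pol_funs_zero pol_funs_add)

text \<open>Polynomials in one further variable whose coefficients depend polynomially on
  \<open>e\<close>. The bound \<open>n\<close> is a formal degree: the true degree may drop at
  particular environments.\<close>

definition pol_families :: "'a::field set \<Rightarrow> nat \<Rightarrow> ((nat \<Rightarrow> 'a) \<Rightarrow> 'a poly) set" where
  "pol_families A n = {p. (\<forall>i. (\<lambda>e. coeff (p e) i) \<in> pol_funs A) \<and> (\<forall>e. degree (p e) \<le> n)}"

lemma coeff_pol_families: "p \<in> pol_families A n \<Longrightarrow> (\<lambda>e. coeff (p e) i) \<in> pol_funs A"
  and degree_pol_families: "p \<in> pol_families A n \<Longrightarrow> degree (p e) \<le> n"
  by (auto simp: pol_families_def)

lemma pol_families_mono: "m \<le> n \<Longrightarrow> pol_families A m \<subseteq> pol_families A n"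
  by (auto simp: pol_families_def intro: order_trans)

lemma pol_families_diff:
  "p \<in> pol_families A n \<Longrightarrow> q \<in> pol_families A n \<Longrightarrow> (\<lambda>e. p e - q e) \<in> pol_families A n"
  by (auto simp: pol_families_def intro: pol_funs.diff degree_diff_le)

lemma pol_families_mult:
  assumes "p \<in> pol_families A m" "q \<in> pol_families A n"
  shows "(\<lambda>e. p e * q e) \<in> pol_families A (m + n)"
proof -
  have "(\<lambda>e. coeff (p e * q e) i) \<in> pol_funs A" for i
    unfolding coeff_mult by (intro pol_funs_sum pol_funs.mult assms[THEN coeff_pol_families])
  moreover have "degree (p e * q e) \<le> m + n" for e
    using degree_mult_le[of "p e" "q e"] assms[THEN degree_pol_families, of e] by linarith
  ultimately show ?thesis
    by (simp add: pol_families_def)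
qed

lemma pol_families_monom:
  assumes "f \<in> pol_funs A"
  shows "(\<lambda>e. monom (f e) n) \<in> pol_families A n"
proof -
  have "(\<lambda>e. coeff (monom (f e) n) i) \<in> pol_funs A" for i
    using assms by (cases "i = n") (auto intro: pol_funs_zero)
  then show ?thesis
    by (auto simp: pol_families_def degree_monom_le)
qed

lemma pol_families_pderiv:
  assumes "p \<in> pol_families A n"
  shows "(\<lambda>e. pderiv (p e)) \<in> pol_families A (n - 1)"
proof -
  have "(\<lambda>e. coeff (pderiv (p e)) i) \<in> pol_funs A" for i
    unfolding coeff_pderiv by (intro pol_funs.mult pol_funs_of_nat coeff_pol_families[OF assms])
  moreover have "degree (pderiv (p e)) \<le> n - 1" for e
    using degree_pderiv_le_diff[of "p e"] degree_pol_families[OF assms, of e] by linarith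
  ultimately show ?thesis
    by (simp add: pol_families_def)
qed

lemma finite_subset_pol_families:
  assumes "finite P" "P \<subseteq> (\<Union>n. pol_families A n)"
  obtains n where "P \<subseteq> pol_families A n"
proof -
  have "\<exists>n. P \<subseteq> pol_families A n"
    using assms
  proof (induction P)
    case (insert p P)
    then obtain m n where "p \<in> pol_families A m" "P \<subseteq> pol_families A n"
      by auto
    then have "insert p P \<subseteq> pol_families A (max m n)"
      using pol_families_mono[of m "max m n" A] pol_families_mono[of n "max m n" A] by auto
    then show ?case by blast
  qed auto
  with that show thesis by blast
qed

text \<open>Multiplying by the formal leading coefficient of \<open>p\<close> avoids division, so
  the remainder again has coefficients polynomial in \<open>e\<close>. Only roots of
  \<open>p\<close> are considered, so multiples of \<open>p\<close> can be discarded.\<close>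

lemma pseudo_remainder:
  assumes p: "p \<in> pol_families A (Suc d)" and q: "q \<in> pol_families A n"
  shows "\<exists>r\<in>pol_families A d. \<exists>m. \<forall>e c. poly (p e) c = 0 \<longrightarrow>
      coeff (p e) (Suc d) ^ m * poly (q e) c = poly (r e) c"
  using q
  proof (induction n arbitrary: q)
  case 0
  then have "q \<in> pol_families A d"
    using pol_families_mono[of 0 d A] by auto
  then show ?case
    by (intro bexI[of _ q] exI[of _ 0]) auto
  next
  case (Suc n)
  show ?case
  proof (cases "Suc n \<le> d")
    case True
    then have "q \<in> pol_families A d"
      using Suc.prems pol_families_mono[of "Suc n" d A] by auto
    then show ?thesis
      by (intro bexI[of _ q] exI[of _ 0]) auto
  next
    case False
    then have n: "n - d + Suc d = Suc n" "0 + Suc n = Suc n"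
      by auto
    let ?a = "\<lambda>e. coeff (p e) (Suc d)" and ?b = "\<lambda>e. coeff (q e) (Suc n)"
    \<comment> \<open>Both products have the same coefficient in degree \<open>Suc n\<close>, so the
      degree bound drops by one.\<close>
    define q1 where
      "q1 = (\<lambda>e. monom (?a e) 0 * q e - monom (?b e) (n - d) * p e)"
    have "(\<lambda>e. monom (?a e) 0 * q e) \<in> pol_families A (0 + Suc n)"
      by (intro pol_families_mult pol_families_monom Suc.prems coeff_pol_families[OF p])
    moreover have "(\<lambda>e. monom (?b e) (n - d) * p e) \<in> pol_families A (n - d + Suc d)"
      by (intro pol_families_mult pol_families_monom p coeff_pol_families[OF Suc.prems])
    ultimately have q1: "q1 \<in> pol_families A (Suc n)"
      unfolding q1_def n by (rule pol_families_diff)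
    moreover have "degree (q1 e) \<le> n" for e
    proof -
      have "n - d \<le> Suc n" "Suc n - (n - d) = Suc d"
        using False by auto
      then have "coeff (q1 e) (Suc n) = 0"
        by (simp add: q1_def coeff_monom_mult)
      with degree_pol_families[OF q1, of e] show ?thesis
        by (metis le_SucE le_degree leading_coeff_0_iff degree_0 zero_le)
    qed
    ultimately have "q1 \<in> pol_families A n"
      by (simp add: pol_families_def)
    then obtain r m where r: "r \<in> pol_families A d"
      and rm: "\<And>e c. poly (p e) c = 0 \<Longrightarrow> ?a e ^ m * poly (q1 e) c = poly (r e) c"
      using Suc.IH by blast
    have "?a e ^ Suc m * poly (q e) c = poly (r e) c" if "poly (p e) c = 0" for e c
      using rm[OF that] that by (simp add: q1_def poly_monom mult_ac)
    with r show ?thesis by blast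
  qed
qed

definition pderiv_closed :: "('e \<Rightarrow> 'a::field poly) set \<Rightarrow> bool" where
  "pderiv_closed D \<longleftrightarrow> (\<forall>q\<in>D. (\<lambda>e. pderiv (q e)) \<in> D)"

lemma pderiv_closed_higher:
  "pderiv_closed D \<Longrightarrow> q \<in> D \<Longrightarrow> (\<lambda>e. (pderiv ^^ j) (q e)) \<in> D"
  by (induction j) (auto simp: pderiv_closed_def)

lemma pderiv_closed_Un:
  "pderiv_closed D \<Longrightarrow> pderiv_closed D' \<Longrightarrow> pderiv_closed (D \<union> D')"
  by (auto simp: pderiv_closed_def)

lemma pderiv_closure:
  assumes "finite P" "P \<subseteq> pol_families A n"
  obtains D where "finite D" "P \<subseteq> D" "D \<subseteq> pol_families A n" "pderiv_closed D"
proof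
  \<comment> \<open>Derivatives of order \<open>Suc n\<close> are zero, so stopping there already
    closes the family under derivatives.\<close>
  define D where "D = (\<Union>j\<le>Suc n. (\<lambda>q e. (pderiv ^^ j) (q e)) ` P)"
  show "finite D"
    using assms(1) by (simp add: D_def)
  show "P \<subseteq> D"
  proof
    fix q assume "q \<in> P"
    then show "q \<in> D"
      unfolding D_def by (intro UN_I[of 0] image_eqI[of _ _ q]) auto
  qed
  have in_families: "(\<lambda>e. (pderiv ^^ j) (q e)) \<in> pol_families A n"
    if "q \<in> pol_families A n" for q j
  proof (induction j)
    case (Suc j)
    then show ?case
      using pol_families_pderiv[OF Suc] pol_families_mono[of "n - 1" n A] by auto
  qed (use that in simp)
  then show "D \<subseteq> pol_families A n"
    unfolding D_def using assms(2) by blast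
  have "(\<lambda>e. pderiv ((pderiv ^^ j) (q e))) \<in> D" if q: "q \<in> P" and j: "j \<le> Suc n" for q j
  proof -
    have zero: "(pderiv ^^ i) (q e) = 0" if "i > n" for i e
      using degree_pol_families[of q A n e] q assms(2) that
      by (intro higher_pderiv_eq_0) auto
    have "(\<lambda>e. (pderiv ^^ min (Suc j) (Suc n)) (q e)) \<in> D"
      unfolding D_def using q by (intro UN_I[of "min (Suc j) (Suc n)"] image_eqI[of _ _ q]) auto
    moreover have "(\<lambda>e. (pderiv ^^ min (Suc j) (Suc n)) (q e)) = (\<lambda>e. (pderiv ^^ Suc j) (q e))"
    proof (cases "Suc j \<le> Suc n")
      case False
      then show ?thesis
        using zero[of "Suc j"] zero[of "Suc n"] by (simp add: min_def del: funpow.simps)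
    qed (simp add: min_def)
    ultimately show ?thesis by simp
  qed
  then show "pderiv_closed D"
    unfolding pderiv_closed_def by (auto simp: D_def)
qed


section \<open>Matching roots and points\<close>

locale leading_terms = henselian_field +
  fixes k :: 'a
  assumes level: "k \<noteq> 0" "k \<preceq> 1"
begin

abbreviation rvk :: "'a \<Rightarrow> 'a set" where
  "rvk \<equiv> rv \<O> (val \<O> k)"

definition agree :: "('e \<Rightarrow> 'a) set \<Rightarrow> 'e \<Rightarrow> 'e \<Rightarrow> bool" where
  "agree Q e e' \<longleftrightarrow> (\<forall>q\<in>Q. rvk (q e) = rvk (q e'))"

lemma agree_Un [simp]: "agree (Q \<union> Q') e e' \<longleftrightarrow> agree Q e e' \<and> agree Q' e e'"
  by (auto simp: agree_def)

lemma agree_UN [simp]: "agree (\<Union>i\<in>I. Q i) e e' \<longleftrightarrow> (\<forall>i\<in>I. agree (Q i) e e')"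
  by (auto simp: agree_def)

text \<open>\<open>Q\<close> is fixed before the environments and the root. The extra family
  \<open>P\<close> makes the matching root usable as a center, where Taylor coefficients of other
  polynomials have to match too.\<close>

definition roots_match ::
  "'a set \<Rightarrow> ((nat \<Rightarrow> 'a) \<Rightarrow> 'a poly) \<Rightarrow> ((nat \<Rightarrow> 'a) \<Rightarrow> 'a poly) set \<Rightarrow> bool" where
  "roots_match A p P \<longleftrightarrow> (\<exists>Q. finite Q \<and> Q \<subseteq> pol_funs A \<and>
     (\<forall>e e' c. agree Q e e' \<and> p e \<noteq> 0 \<and> poly (p e) c = 0 \<longrightarrow>
        (\<exists>c'. p e' \<noteq> 0 \<and> poly (p e') c' = 0 \<and> (\<forall>q\<in>P. rvk (poly (q e) c) = rvk (poly (q e') c')))))"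

text \<open>Up to nonzero factorials, Taylor coefficients are values of higher derivatives, and
  these belong to \<open>W\<close>.\<close>

lemma taylor_coeffs_match:
  assumes W: "\<And>w. w \<in> W \<Longrightarrow> rvk (poly (w e) c) = rvk (poly (w e') c')"
    and "pderiv_closed W" "w \<in> W"
  shows "rvk (coeff (shift c (w e)) j) = rvk (coeff (shift c' (w e')) j)"
proof (rule rv_mult_cancel[OF level])
  show "of_nat (fact j) \<noteq> (0 :: 'a)"
    by (intro of_nat_neq_0) simp
  show "rvk (of_nat (fact j) * coeff (shift c (w e)) j) =
      rvk (of_nat (fact j) * coeff (shift c' (w e')) j)"
    unfolding fact_mult_coeff_shift
    using W[OF pderiv_closed_higher[OF assms(2,3), of j]] .
qed (rule refl)

text \<open>The center is a nearest point among \<open>0\<close> and the roots of the family: there the Taylor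
  expansions at \<open>y\<close> have no cancellation, so they can be evaluated on leading terms.\<close>

lemma centers_match:
  assumes D: "finite D" "pderiv_closed D"
    and W: "finite W" "W \<subseteq> (\<Union>n. pol_families A n)"
    and match: "\<forall>p\<in>D. roots_match A p W"
  shows "\<exists>Q. finite Q \<and> Q \<subseteq> pol_funs A \<and> (\<forall>e e' y. agree Q e e' \<longrightarrow> (\<exists>c c'.
       (\<forall>q\<in>D. \<forall>j. coeff (shift c (q e)) j * (y - c) ^ j \<preceq> poly (q e) y) \<and>
       (\<forall>w\<in>W. rvk (poly (w e) c) = rvk (poly (w e') c'))))"
proof -
  have "\<forall>p\<in>D. \<exists>Q. finite Q \<and> Q \<subseteq> pol_funs A \<and>
     (\<forall>e e' c. agree Q e e' \<and> p e \<noteq> 0 \<and> poly (p e) c = 0 \<longrightarrow>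
        (\<exists>c'. p e' \<noteq> 0 \<and> poly (p e') c' = 0 \<and> (\<forall>q\<in>W. rvk (poly (q e) c) = rvk (poly (q e') c'))))"
    using match by (simp add: roots_match_def)
  from bchoice[OF this] obtain QD where QD': "\<forall>p\<in>D. finite (QD p) \<and> QD p \<subseteq> pol_funs A \<and>
     (\<forall>e e' c. agree (QD p) e e' \<and> p e \<noteq> 0 \<and> poly (p e) c = 0 \<longrightarrow>
        (\<exists>c'. p e' \<noteq> 0 \<and> poly (p e') c' = 0 \<and> (\<forall>q\<in>W. rvk (poly (q e) c) = rvk (poly (q e') c'))))"
    ..
  then have QD: "\<And>p. p \<in> D \<Longrightarrow> finite (QD p)" "\<And>p. p \<in> D \<Longrightarrow> QD p \<subseteq> pol_funs A"
    by blast+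
  from QD' have root: "\<exists>c'. \<forall>q\<in>W. rvk (poly (q e) c) = rvk (poly (q e') c')"
    if "p \<in> D" "agree (QD p) e e'" "p e \<noteq> 0" "poly (p e) c = 0" for p e e' c
    using that by blast
  \<comment> \<open>A center 0 is matched with 0, and values at 0 are constant coefficients.\<close>
  define Q0 where "Q0 = (\<lambda>w e. coeff (w e) 0) ` W"
  define Q where "Q = (\<Union>p\<in>D. QD p) \<union> Q0"
  show ?thesis
  proof (intro exI[of _ Q] conjI allI impI)
    show "finite Q"
      using D QD W by (simp add: Q_def Q0_def)
    have "Q0 \<subseteq> pol_funs A"
      unfolding Q0_def using W(2) coeff_pol_families by blast
    then show "Q \<subseteq> pol_funs A"
      using QD(2) by (auto simp: Q_def)
  next
    fix e e' y
    assume "agree Q e e'"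
    then have agree: "\<And>p. p \<in> D \<Longrightarrow> agree (QD p) e e'" "agree Q0 e e'"
      by (auto simp: Q_def)
    \<comment> \<open>The point 0 keeps the set of centers nonempty when there are no roots.\<close>
    define C where "C = insert 0 (\<Union>p\<in>{p\<in>D. p e \<noteq> 0}. {z. poly (p e) z = 0})"
    have "finite C" "C \<noteq> {}"
      using D(1) by (auto simp: C_def intro!: poly_roots_finite)
    then obtain c where c: "c \<in> C" "\<And>z. z \<in> C \<Longrightarrow> y - c \<preceq> y - z"
      by (rule ex_nearest[where f = "\<lambda>z. y - z"]) blast
    have "\<exists>c'. \<forall>w\<in>W. rvk (poly (w e) c) = rvk (poly (w e') c')"
    proof (cases "c = 0")
      case True
      have "rvk (poly (w e) c) = rvk (poly (w e') 0)" if "w \<in> W" for w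
        using agree(2) that by (auto simp: True agree_def Q0_def poly_0_coeff_0)
      then show ?thesis by blast
    next
      case False
      then show ?thesis
        using c(1) root agree(1) by (auto simp: C_def)
    qed
    moreover have "coeff (shift c (q e)) j * (y - c) ^ j \<preceq> poly (q e) y" if "q \<in> D" for q j
    proof (rule taylor_coeff_le_of_nearest)
      fix i z
      assume "(pderiv ^^ i) (q e) \<noteq> 0" "poly ((pderiv ^^ i) (q e)) z = 0"
      then have "z \<in> C"
        using pderiv_closed_higher[OF D(2) that, of i] by (auto simp: C_def)
      then show "y - c \<preceq> z - y"
        using c(2) by (metis minus_diff_eq le_uminus_iff)
    qed
    ultimately show "\<exists>c c'.
       (\<forall>q\<in>D. \<forall>j. coeff (shift c (q e)) j * (y - c) ^ j \<preceq> poly (q e) y) \<and>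
       (\<forall>w\<in>W. rvk (poly (w e) c) = rvk (poly (w e') c'))"
      by blast
  qed
qed

section \<open>Transferring roots and points to matching centers\<close>

lemma taylor_coeffs_le_of_pderiv:
  assumes "\<And>j. coeff (shift c (pderiv q)) j * u ^ j \<preceq> M"
  shows "coeff (shift c q) (Suc j) * u ^ Suc j \<preceq> M * u"
proof -
  have "of_nat (Suc j) * (coeff (shift c q) (Suc j) * u ^ j) \<preceq> M"
    using assms[of j] by (simp only: coeff_shift_pderiv[symmetric] mult.assoc)
  then have "coeff (shift c q) (Suc j) * u ^ j \<preceq> M"
    using of_nat_mult_le_iff by blast
  then have "coeff (shift c q) (Suc j) * u ^ j * u \<preceq> M * u"
    by (rule le_mult[OF _ le_refl])
  then show ?thesis
    by (simp add: mult_ac)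
qed

text \<open>At a root, the constant term is minus the sum of the other terms.\<close>

lemma constant_coeff_le_of_root:
  assumes "poly t u = 0" "\<And>j. coeff t (Suc j) * u ^ Suc j \<preceq> M"
  shows "coeff t 0 \<preceq> M"
proof -
  obtain b s where t: "t = pCons b s"
    by (cases t)
  have "u * poly s u = (\<Sum>j\<le>degree s. coeff t (Suc j) * u ^ Suc j)"
    by (simp add: poly_altdef t sum_distrib_left mult_ac)
  also have "\<dots> \<preceq> M"
    by (intro le_sum assms(2))
  also have "u * poly s u = - b"
    using assms(1) by (simp add: t eq_neg_iff_add_eq_0 add.commute)
  finally show ?thesis
    by (simp add: t)
qed

text \<open>If \<open>p'\<close> has no cancellation at \<open>c + u\<close>, then \<open>c' + u\<close> is an approximate root to which
  Hensel's lemma applies.\<close>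

lemma root_at_matching_center:
  assumes u: "u \<noteq> 0" and p: "p \<noteq> 0" "poly p (c + u) = 0" "degree p > 0"
    and coeffs: "\<And>j. rvk (coeff (shift c p) j) = rvk (coeff (shift c' p') j)"
    and coeffs_pderiv: "\<And>j. rvk (coeff (shift c (pderiv p)) j) = rvk (coeff (shift c' (pderiv p')) j)"
    and dominated: "\<And>j. coeff (shift c (pderiv p)) j * u ^ j \<preceq> poly (pderiv p) (c + u)"
  obtains u' where "poly p' (c' + u') = 0" "rvk u = rvk u'"
proof -
  let ?t = "shift c p" and ?t' = "shift c' p'"
  \<comment> \<open>\<open>M\<close> will bound every Taylor term of \<open>p\<close> at radius |u|.
    The name \<open>p'\<close> stands for the matching polynomial, and \<open>M'\<close> is the
    linear term at \<open>u\<close> of its expansion around \<open>c' + u\<close>.\<close>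
  define M where "M = poly (pderiv p) (c + u) * u"
  define M' where "M' = poly (pderiv p') (c' + u) * u"
  have "coeff ?t (Suc j) * u ^ Suc j \<preceq> M" for j
    unfolding M_def using dominated by (rule taylor_coeffs_le_of_pderiv)
  moreover from this have "coeff ?t 0 \<preceq> M"
    using p(2) by (intro constant_coeff_le_of_root[of _ u]) auto
  ultimately have tM: "coeff ?t j * u ^ j \<preceq> M" for j
    by (cases j) auto
  have "M \<noteq> 0"
  proof
    assume "M = 0"
    then have "coeff ?t (degree p) = 0"
      using tM[of "degree p"] u by simp
    then have "?t = 0"
      by (metis degree_shift leading_coeff_0_iff)
    with p(3) show False
      by (metis degree_0 degree_shift less_numeral_extra(3))
  qed
  have "rvk (poly (shift c (pderiv p)) u) = rvk (poly (shift c' (pderiv p')) u)"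
    using dominated by (intro rv_poly_cong_of_dominated[OF level coeffs_pderiv refl]) simp
  then have rvM: "rvk M = rvk M'"
    unfolding M_def M'_def by (intro rv_mult[OF level _ refl]) simp
  then have MM': "M \<preceq> M'" "M' \<preceq> M"
    using rv_eq_imp_le[OF level] by metis+
  then have "M' \<noteq> 0"
    using \<open>M \<noteq> 0\<close> by auto
  define r where "r = shift u ?t'"
  have r1: "coeff r 1 = poly (pderiv p') (c' + u)"
    using coeff_shift_pderiv[of 0 "c' + u" p'] by (simp add: r_def shift_shift coeff_shift_0)
  then have r1u: "coeff r 1 * u = M'"
    by (simp add: M'_def)
  \<comment> \<open>Since \<open>p\<close> vanishes at \<open>c + u\<close>, this makes
    \<open>c' + u\<close> an approximate root of \<open>p'\<close>.\<close>
  have "poly ?t u - poly ?t' u \<prec> k * M"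
    using rv_poly_cong[OF level coeffs refl tM \<open>M \<noteq> 0\<close>] .
  then have "coeff r 0 \<prec> k * M"
    using p(2) by (simp add: r_def coeff_shift_0)
  also have "k * M \<preceq> k * M'"
    using MM' by (intro le_mult le_refl)
  finally have r0: "coeff r 0 \<prec> k * M'" .
  also have "k * M' \<preceq> 1 * M'"
    by (intro le_mult level le_refl)
  finally have r0': "coeff r 0 \<prec> coeff r 1 * u"
    unfolding r1u by simp
  have "coeff ?t' j * u ^ j \<preceq> M'" for j
  proof -
    have "coeff ?t' j \<preceq> coeff ?t j"
      using rv_eq_imp_le[OF level coeffs[symmetric]] .
    then have "coeff ?t' j * u ^ j \<preceq> coeff ?t j * u ^ j"
      by (rule le_mult[OF _ le_refl])
    then show ?thesis
      using tM MM'(1) le_trans by blast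
  qed
  then have "coeff r j * u ^ j \<preceq> coeff r 1 * u" for j
    unfolding r1u unfolding r_def by (intro coeff_shift_le[OF u le_refl])
  then obtain v where v: "poly r v = 0" "coeff r 1 * v \<preceq> coeff r 0"
    using hensel_root[OF u _ r0'] by blast
  \<comment> \<open>The correction \<open>v\<close> is controlled by the constant term of
    \<open>r\<close>; being below |k * u|, it leaves the leading term of \<open>u\<close>
    unchanged.\<close>
  have "coeff r 1 * v \<prec> coeff r 1 * (k * u)"
    using le_lt_trans[OF v(2) r0] by (simp add: r1u[symmetric] mult_ac)
  moreover have "coeff r 1 \<noteq> 0"
    using \<open>M' \<noteq> 0\<close> r1u by auto
  ultimately have "v \<prec> k * u"
    using lt_mult_cancel by blast
  then have "rvk u = rvk (u + v)"
    unfolding rv_eq_iff[OF level] by simp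
  moreover have "poly p' (c' + (u + v)) = 0"
    using v(1) by (simp add: r_def add.assoc)
  ultimately show thesis
    using that by blast
qed

text \<open>Induction on the formal degree. Where the formal leading coefficient vanishes,
  \<open>p\<close> equals its truncation \<open>trunc\<close>. Elsewhere centers come from the
  derivative of \<open>p\<close> and the pseudo-remainders modulo \<open>p\<close>, which the
  induction hypothesis covers.\<close>

lemma roots_match:
  assumes "p \<in> pol_families A d" "finite P" "P \<subseteq> (\<Union>n. pol_families A n)"
  shows "roots_match A p P"
  using assms
proof (induction d arbitrary: p P)
  case 0
  have no_root: "p e = 0" if root: "poly (p e) c = 0" for e c
  proof -
    have "degree (p e) = 0"
      using degree_pol_families[OF 0(1), of e] by simp
    then obtain b where b: "p e = [:b:]"
      by (rule degree_eq_zeroE)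
    with root show ?thesis by simp
  qed
  show ?case
    unfolding roots_match_def
  proof (intro exI[of _ "{}"] conjI allI impI)
    fix e e' c
    assume "agree {} e e' \<and> p e \<noteq> 0 \<and> poly (p e) c = 0"
    then have False
      using no_root by blast
    then show "\<exists>c'. p e' \<noteq> 0 \<and> poly (p e') c' = 0 \<and>
        (\<forall>q\<in>P. rvk (poly (q e) c) = rvk (poly (q e') c'))" ..
  qed auto
next
  case (Suc d)
  define a where "a = (\<lambda>e. coeff (p e) (Suc d))"
  have a: "a \<in> pol_funs A"
    unfolding a_def by (rule coeff_pol_families[OF Suc.prems(1)])
  define trunc where "trunc = (\<lambda>e. p e - monom (a e) (Suc d))"
  have trunc1: "trunc \<in> pol_families A (Suc d)"
    unfolding trunc_def by (intro pol_families_diff pol_families_monom Suc.prems a)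
  have "degree (trunc e) \<le> d" for e
  proof -
    have "coeff (trunc e) (Suc d) = 0"
      by (simp add: trunc_def a_def)
    with degree_pol_families[OF trunc1, of e] show ?thesis
      by (metis le_SucE leading_coeff_0_iff degree_0 zero_order(1))
  qed
  with trunc1 have "trunc \<in> pol_families A d"
    by (simp add: pol_families_def)
  then have "roots_match A trunc P"
    using Suc.IH Suc.prems by blast
  then obtain Q1 where Q1: "finite Q1" "Q1 \<subseteq> pol_funs A"
    and trunc_match: "\<forall>e e' c. agree Q1 e e' \<and> trunc e \<noteq> 0 \<and> poly (trunc e) c = 0 \<longrightarrow>
      (\<exists>c'. trunc e' \<noteq> 0 \<and> poly (trunc e') c' = 0 \<and>
        (\<forall>q\<in>P. rvk (poly (q e) c) = rvk (poly (q e') c')))"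
    unfolding roots_match_def by (elim exE conjE) (rule that)

  have "\<exists>r m. r \<in> pol_families A d \<and>
      (\<forall>e c. poly (p e) c = 0 \<longrightarrow> a e ^ m * poly (q e) c = poly (r e) c)" if "q \<in> P" for q
  proof -
    obtain n where "q \<in> pol_families A n"
      using \<open>q \<in> P\<close> Suc.prems(3) by blast
    from pseudo_remainder[OF Suc.prems(1) this] show ?thesis
      unfolding a_def by (simp only: Bex_def ex_simps)
  qed
  then have "\<forall>q\<in>P. \<exists>r m. r \<in> pol_families A d \<and>
      (\<forall>e c. poly (p e) c = 0 \<longrightarrow> a e ^ m * poly (q e) c = poly (r e) c)"
    by blast
  from bchoice[OF this] obtain r where r': "\<forall>q\<in>P. \<exists>m. r q \<in> pol_families A d \<and>
      (\<forall>e c. poly (p e) c = 0 \<longrightarrow> a e ^ m * poly (q e) c = poly (r q e) c)"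
    ..
  then have r: "r q \<in> pol_families A d" if "q \<in> P" for q
    using that by blast
  from bchoice[OF r'] obtain m where "\<forall>q\<in>P. r q \<in> pol_families A d \<and>
      (\<forall>e c. poly (p e) c = 0 \<longrightarrow> a e ^ m q * poly (q e) c = poly (r q e) c)"
    ..
  then have rm: "a e ^ m q * poly (q e) c = poly (r q e) c" if "q \<in> P" "poly (p e) c = 0" for q e c
    using that by blast
  have p': "(\<lambda>e. pderiv (p e)) \<in> pol_families A d"
    using pol_families_pderiv[OF Suc.prems(1)] by simp
  have "finite (insert (\<lambda>e. pderiv (p e)) (r ` P))"
      "insert (\<lambda>e. pderiv (p e)) (r ` P) \<subseteq> pol_families A d"
    using Suc.prems(2) p' r by auto
  then obtain D where D: "finite D" "D \<subseteq> pol_families A d" "pderiv_closed D"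
    and DP: "insert (\<lambda>e. pderiv (p e)) (r ` P) \<subseteq> D"
    by (rule pderiv_closure)
  obtain W' where W': "finite W'" "{p} \<subseteq> W'" "W' \<subseteq> pol_families A (Suc d)" "pderiv_closed W'"
    using pderiv_closure[of "{p}" A "Suc d"] Suc.prems(1) by auto
  \<comment> \<open>The center has to match on \<open>D\<close> to evaluate the remainders, and on
    \<open>p\<close> with its derivatives to transfer the root.\<close>
  define W where "W = D \<union> W'"
  have W: "finite W" "W \<subseteq> (\<Union>n. pol_families A n)" "pderiv_closed W" "p \<in> W" "D \<subseteq> W"
    using D W' by (auto simp: W_def intro: pderiv_closed_Un)
  have "\<forall>q\<in>D. roots_match A q W"
    using Suc.IH D(2) W by blast
  from centers_match[OF D(1,3) W(1,2) this]
  obtain Q2 where Q2: "finite Q2" "Q2 \<subseteq> pol_funs A"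
    and centers: "\<forall>e e' y. agree Q2 e e' \<longrightarrow> (\<exists>c c'.
       (\<forall>q\<in>D. \<forall>j. coeff (shift c (q e)) j * (y - c) ^ j \<preceq> poly (q e) y) \<and>
       (\<forall>w\<in>W. rvk (poly (w e) c) = rvk (poly (w e') c')))"
    by (elim exE conjE) (rule that)

  have "\<exists>y'. p e' \<noteq> 0 \<and> poly (p e') y' = 0 \<and> (\<forall>q\<in>P. rvk (poly (q e) y) = rvk (poly (q e') y'))"
    if agree: "agree Q1 e e'" "agree Q2 e e'" "rvk (a e) = rvk (a e')"
      and y: "p e \<noteq> 0" "poly (p e) y = 0" for e e' y
  proof (cases "a e = 0")
    case True
    then have "a e' = 0"
      using agree(3) rv_eq_zero_iff[OF level] by metis
    with True have "trunc e = p e" "trunc e' = p e'"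
      by (simp_all add: trunc_def)
    then show ?thesis
      using trunc_match[rule_format, of e e' y] agree(1) y by simp
  next
    case False
    then have "a e' \<noteq> 0"
      using agree(3) rv_eq_zero_iff[OF level] by metis
    then have "p e' \<noteq> 0"
      by (auto simp: a_def)
    have deg: "degree (p e) > 0"
      using False le_degree[of "p e" "Suc d"] by (simp add: a_def)
    obtain c c' where
      dominated: "\<And>q j. q \<in> D \<Longrightarrow> coeff (shift c (q e)) j * (y - c) ^ j \<preceq> poly (q e) y"
      and match: "\<And>w. w \<in> W \<Longrightarrow> rvk (poly (w e) c) = rvk (poly (w e') c')"
      using centers[rule_format, OF agree(2), of y] by blast
    have coeffs: "rvk (coeff (shift c (w e)) j) = rvk (coeff (shift c' (w e')) j)" if "w \<in> W" for w j
      using match W(3) that by (rule taylor_coeffs_match)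
    have p'D: "(\<lambda>e. pderiv (p e)) \<in> D"
      using DP by simp
    \<comment> \<open>The matching root is \<open>c' + u'\<close>. If the center is the root itself,
      \<open>c'\<close> already is a root and \<open>u' = 0\<close>.\<close>
    obtain u' where u': "poly (p e') (c' + u') = 0" "rvk (y - c) = rvk u'"
    proof (cases "y = c")
      case True
      then have "poly (p e') (c' + 0) = 0"
        using match[OF W(4)] y(2) rv_eq_zero_iff[OF level] by (metis add.right_neutral)
      then show thesis
        using that[of 0] True by simp
    next
      case False
      then have u: "y - c \<noteq> 0" by simp
      show thesis
      proof (rule root_at_matching_center[OF u y(1) _ deg coeffs[OF W(4)]])
        show "poly (p e) (c + (y - c)) = 0"
          using y(2) by simp
        show "rvk (coeff (shift c (pderiv (p e))) j) = rvk (coeff (shift c' (pderiv (p e'))) j)" for j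
          using coeffs[OF subsetD[OF W(5) p'D]] .
        show "coeff (shift c (pderiv (p e))) j * (y - c) ^ j \<preceq> poly (pderiv (p e)) (c + (y - c))" for j
          using dominated[OF p'D] by simp
      qed (rule that)
    qed
    \<comment> \<open>The remainder of \<open>q\<close> lies in \<open>D\<close>, so it has no
      cancellation at \<open>y\<close>; afterwards the power of the leading coefficient is divided
      out.\<close>
    have "rvk (poly (q e) y) = rvk (poly (q e') (c' + u'))" if "q \<in> P" for q
    proof (rule rv_mult_cancel[OF level])
      show "a e ^ m q \<noteq> 0"
        using False by simp
      show "rvk (a e ^ m q) = rvk (a e' ^ m q)"
        by (rule rv_power[OF level agree(3)])
      have rq: "r q \<in> D"
        using DP that by blast
      have "rvk (poly (shift c (r q e)) (y - c)) = rvk (poly (shift c' (r q e')) u')"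
        using dominated[OF rq] by (intro rv_poly_cong_of_dominated[OF level coeffs u'(2)])
          (use rq W(5) in auto)
      then show "rvk (a e ^ m q * poly (q e) y) = rvk (a e' ^ m q * poly (q e') (c' + u'))"
        using rm[OF that y(2)] rm[OF that u'(1)] by simp
    qed
    with u'(1) \<open>p e' \<noteq> 0\<close> show ?thesis by blast
  qed
  moreover have "finite (insert a (Q1 \<union> Q2))" "insert a (Q1 \<union> Q2) \<subseteq> pol_funs A"
    using a Q1 Q2 by auto
  moreover have "agree (insert a (Q1 \<union> Q2)) e e' \<longleftrightarrow>
      agree Q1 e e' \<and> agree Q2 e e' \<and> rvk (a e) = rvk (a e')" for e e'
    by (auto simp: agree_def)
  ultimately show ?case
    unfolding roots_match_def by (intro exI[of _ "insert a (Q1 \<union> Q2)"] conjI) blast+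
qed

text \<open>This eliminates one field quantifier. Roots of every member of the family may now serve
  as centers, and the matching point is \<open>c' + (y - c)\<close>.\<close>

lemma points_match:
  assumes P: "finite P" "P \<subseteq> (\<Union>n. pol_families A n)"
  shows "\<exists>Q. finite Q \<and> Q \<subseteq> pol_funs A \<and>
    (\<forall>e e' y. agree Q e e' \<longrightarrow> (\<exists>y'. \<forall>q\<in>P. rvk (poly (q e) y) = rvk (poly (q e') y')))"
proof -
  obtain n where "P \<subseteq> pol_families A n"
    using finite_subset_pol_families[OF P] .
  with P(1) obtain D where D: "finite D" "P \<subseteq> D" "D \<subseteq> pol_families A n" "pderiv_closed D"
    by (rule pderiv_closure)
  have D': "D \<subseteq> (\<Union>n. pol_families A n)"
    using D(3) by blast
  have "\<forall>q\<in>D. roots_match A q D"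
    using roots_match[OF subsetD[OF D(3)] D(1) D'] by blast
  from centers_match[OF D(1,4,1) D' this]
  obtain Q where Q: "finite Q" "Q \<subseteq> pol_funs A"
    and centers: "\<forall>e e' y. agree Q e e' \<longrightarrow> (\<exists>c c'.
       (\<forall>q\<in>D. \<forall>j. coeff (shift c (q e)) j * (y - c) ^ j \<preceq> poly (q e) y) \<and>
       (\<forall>w\<in>D. rvk (poly (w e) c) = rvk (poly (w e') c')))"
    by (elim exE conjE) (rule that)
  have "\<exists>y'. \<forall>q\<in>P. rvk (poly (q e) y) = rvk (poly (q e') y')" if agree: "agree Q e e'" for e e' y
  proof -
    obtain c c' where
      dominated: "\<And>q j. q \<in> D \<Longrightarrow> coeff (shift c (q e)) j * (y - c) ^ j \<preceq> poly (q e) y"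
      and match: "\<And>w. w \<in> D \<Longrightarrow> rvk (poly (w e) c) = rvk (poly (w e') c')"
      using centers[rule_format, OF agree, of y] by blast
    have "rvk (poly (q e) y) = rvk (poly (q e') (c' + (y - c)))" if "q \<in> P" for q
    proof -
      have q: "q \<in> D"
        using that D(2) by blast
      have "rvk (poly (shift c (q e)) (y - c)) = rvk (poly (shift c' (q e')) (y - c))"
        using dominated[OF q] taylor_coeffs_match[where W = D, OF match D(4) q]
        by (intro rv_poly_cong_of_dominated[OF level _ refl]) simp_all
      then show ?thesis by simp
    qed
    then show ?thesis by blast
  qed
  with Q show ?thesis by blast
qed

text \<open>Both values come from one expansion at the same center nearest to \<open>x\<close>, so
  only the leading terms of \<open>x - c\<close> and \<open>x' - c\<close> enter.\<close>

lemma rv_poly_eq_of_prepared: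
  assumes C: "finite C" "C \<noteq> {}"
    and roots: "\<And>j z. (pderiv ^^ j) q \<noteq> 0 \<Longrightarrow> poly ((pderiv ^^ j) q) z = 0 \<Longrightarrow> z \<in> C"
    and eq: "\<And>c. c \<in> C \<Longrightarrow> rvk (x - c) = rvk (x' - c)"
  shows "rvk (poly q x) = rvk (poly q x')"
proof -
  obtain c where c: "c \<in> C" "\<And>z. z \<in> C \<Longrightarrow> x - c \<preceq> x - z"
    using ex_nearest[OF C, of "\<lambda>z. x - z"] by blast
  have "coeff (shift c q) j * (x - c) ^ j \<preceq> poly q x" for j
  proof (rule taylor_coeff_le_of_nearest)
    fix i z
    assume "(pderiv ^^ i) q \<noteq> 0" "poly ((pderiv ^^ i) q) z = 0"
    then show "x - c \<preceq> z - x"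
      using c(2) roots by (metis minus_diff_eq le_uminus_iff)
  qed
  then have "rvk (poly (shift c q) (x - c)) = rvk (poly (shift c q) (x' - c))"
    by (intro rv_poly_cong_of_dominated[OF level refl eq[OF c(1)]]) simp
  then show ?thesis by simp
qed

end


section \<open>Formulas are determined by leading terms of polynomials\<close>

lemma pol_funs_shift_env: "f \<in> pol_funs A \<Longrightarrow> (\<lambda>e. f (e \<circ> Suc)) \<in> pol_funs A"
  by (induction rule: pol_funs.induct) (auto intro: pol_funs.intros)

text \<open>Coordinate 0 becomes the variable of a univariate polynomial and the others its
  parameters, the form in which \<open>points_match\<close> treats a quantifier.\<close>

lemma pol_fun_first_variable:
  assumes "f \<in> pol_funs A"
  shows "\<exists>n. \<exists>p\<in>pol_families A n. \<forall>x e. f (case_nat x e) = poly (p e) x"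
  using assms
proof induction
  case (var i)
  show ?case
  proof (cases i)
    case 0
    then show ?thesis
      using pol_families_monom[OF pol_funs.one, of 1 A]
      by (intro exI[of _ 1] bexI[of _ "\<lambda>e. monom 1 1"]) (auto simp: poly_monom)
  next
    case (Suc j)
    then show ?thesis
      using pol_families_monom[OF pol_funs.var[of j], of 0 A]
      by (intro exI[of _ 0] bexI[of _ "\<lambda>e. monom (e j) 0"]) (auto simp: poly_monom)
  qed
next
  case (const a)
  then show ?case
    using pol_families_monom[OF pol_funs.const, of a A 0]
    by (intro exI[of _ 0] bexI[of _ "\<lambda>e. monom a 0"]) (auto simp: poly_monom)
next
  case one
  then show ?case
    using pol_families_monom[OF pol_funs.one, of 0 A]
    by (intro exI[of _ 0] bexI[of _ "\<lambda>e. monom 1 0"]) (auto simp: poly_monom)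
next
  case (diff f g)
  then obtain m n p q where
    "p \<in> pol_families A m" "\<forall>x e. f (case_nat x e) = poly (p e) x"
    "q \<in> pol_families A n" "\<forall>x e. g (case_nat x e) = poly (q e) x"
    by blast
  moreover from this have "(\<lambda>e. p e - q e) \<in> pol_families A (max m n)"
    using pol_families_mono[of m "max m n" A] pol_families_mono[of n "max m n" A]
    by (intro pol_families_diff) auto
  ultimately show ?case
    by (intro exI[of _ "max m n"] bexI[of _ "\<lambda>e. p e - q e"]) auto
next
  case (mult f g)
  then obtain m n p q where
    "p \<in> pol_families A m" "\<forall>x e. f (case_nat x e) = poly (p e) x"
    "q \<in> pol_families A n" "\<forall>x e. g (case_nat x e) = poly (q e) x"
    by blast
  moreover from this have "(\<lambda>e. p e * q e) \<in> pol_families A (m + n)"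
    by (intro pol_families_mult)
  ultimately show ?case
    by (intro exI[of _ "m + n"] bexI[of _ "\<lambda>e. p e * q e"]) auto
qed

lemma pol_funs_first_variable:
  assumes "Q \<subseteq> pol_funs A"
  shows "\<exists>p. p ` Q \<subseteq> (\<Union>n. pol_families A n) \<and>
    (\<forall>q\<in>Q. \<forall>x e. q (case_nat x e) = poly (p q e) x)"
proof -
  have "\<forall>q\<in>Q. \<exists>p. p \<in> (\<Union>n. pol_families A n) \<and> (\<forall>x e. q (case_nat x e) = poly (p e) x)"
  proof
    fix q assume q: "q \<in> Q"
    obtain n p where "p \<in> pol_families A n" "\<forall>x e. q (case_nat x e) = poly (p e) x"
      using pol_fun_first_variable[OF subsetD[OF assms q]] by (elim exE bexE) (rule that)
    then show "\<exists>p. p \<in> (\<Union>n. pol_families A n) \<and> (\<forall>x e. q (case_nat x e) = poly (p e) x)"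
      by (intro exI[of _ p] conjI UN_I[of n UNIV]) simp_all
  qed
  from bchoice[OF this] obtain p where
    p: "\<forall>q\<in>Q. p q \<in> (\<Union>n. pol_families A n) \<and> (\<forall>x e. q (case_nat x e) = poly (p q e) x)" ..
  show ?thesis
  proof (intro exI[of _ p] conjI)
    show "p ` Q \<subseteq> (\<Union>n. pol_families A n)"
      using p by blast
    show "\<forall>q\<in>Q. \<forall>x e. q (case_nat x e) = poly (p q e) x"
      using p by blast
  qed
qed

lemma pol_funs_eval_tm:
  fixes M :: "('a::field, unit, unit) struct"
  assumes "wf_tm pure_language t" "\<And>i. i \<in> fv_tm t \<Longrightarrow> (\<lambda>e. \<sigma> e i) \<in> pol_funs A"
  shows "(\<lambda>e. eval_tm M (\<sigma> e) t) \<in> pol_funs A"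
  using assms
proof (induction t)
  case (Add s t)
  then show ?case
    by (auto intro!: pol_funs_add)
next
  case (Mul s t)
  then show ?case
    by (auto intro!: pol_funs.mult)
qed (simp_all add: pure_language_def)

section \<open>The imaginary sort in terms of the preorder\<close>

context valued_field
begin

lemma rv_map_eq: "rv_map \<O> x l = (if l \<noteq> 0 \<and> l \<preceq> 1 \<and> x \<noteq> 0 then rv \<O> (val \<O> l) x else {0})"
  by (auto simp: rv_map_def val_in_values_le_one_iff rv_zero)

text \<open>The right-hand side uses only equations and comparisons between polynomial expressions,
  so leading terms decide it. Nonzero leading terms agree only if their levels do.\<close>

lemma rv_map_eq_iff:
  "rv_map \<O> x l = rv_map \<O> x' l' \<longleftrightarrow>
     (if l \<noteq> 0 \<and> l \<preceq> 1 \<and> x \<noteq> 0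
      then l' \<noteq> 0 \<and> l' \<preceq> 1 \<and> x' \<noteq> 0 \<and> l \<preceq> l' \<and> l' \<preceq> l \<and> (x - x' \<preceq> 0 \<or> x - x' \<prec> l * x)
      else \<not> (l' \<noteq> 0 \<and> l' \<preceq> 1 \<and> x' \<noteq> 0))"
proof -
  have nz: "rv \<O> (val \<O> l) x \<noteq> {0}" if "l \<noteq> 0" "l \<preceq> 1" "x \<noteq> 0" for l x
    using that rv_zero rv_eq_zero_iff by metis
  have "rv \<O> (val \<O> l) x = rv \<O> (val \<O> l') x' \<longleftrightarrow>
      l \<preceq> l' \<and> l' \<preceq> l \<and> (x - x' \<preceq> 0 \<or> x - x' \<prec> l * x)"
    if l: "l \<noteq> 0" "l \<preceq> 1" and l': "l' \<noteq> 0" "l' \<preceq> 1" and x: "x \<noteq> 0" "x' \<noteq> 0"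
  proof (cases "l \<preceq> l' \<and> l' \<preceq> l")
    case True
    then have "val \<O> l' = val \<O> l"
      by (simp add: val_eq_iff)
    then show ?thesis
      using True rv_eq_iff[OF l] by simp
  next
    case False
    then show ?thesis
      using rv_eq_imp_level_le[OF l l' x(1)] rv_eq_imp_level_le[OF l' l x(2)] by metis
  qed
  then show ?thesis
    unfolding rv_map_eq using nz by auto
qed

text \<open>Version for a constant leading term, whose representative \<open>a\<close> may be any
  field element: \<open>x\<close> is compared with it only through its own leading term.\<close>

lemma rv_map_eq_rv_iff:
  assumes "l' \<noteq> 0" "l' \<preceq> 1"
  shows "rv_map \<O> x l = rv \<O> (val \<O> l') a \<longleftrightarrow>
     (if l \<noteq> 0 \<and> l \<preceq> 1 \<and> x \<noteq> 0
      then l \<preceq> l' \<and> l' \<preceq> l \<and> rv \<O> (val \<O> l') x = rv \<O> (val \<O> l') a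
      else a = 0)"
proof (cases "a = 0")
  case True
  then show ?thesis
    using rv_zero[OF assms(1)] rv_eq_zero_iff[of l x] rv_zero[of l] rv_eq_zero_iff[OF assms, of x]
    by (auto simp: rv_map_eq)
next
  case False
  then have *: "rv \<O> (val \<O> l') a = rv_map \<O> a l'"
    using assms by (simp add: rv_map_eq)
  have "x - a \<preceq> 0 \<or> x - a \<prec> l * x \<longleftrightarrow> rv \<O> (val \<O> l') x = rv \<O> (val \<O> l') a"
    if "l \<noteq> 0" "l \<preceq> 1" "l \<preceq> l'" "l' \<preceq> l"
  proof -
    have "val \<O> l = val \<O> l'"
      using that by (simp add: val_eq_iff)
    then show ?thesis
      using rv_eq_iff[OF that(1,2), of x a] by simp
  qed
  then show ?thesis
    unfolding * rv_map_eq_iff using False assms by (auto simp: *)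
qed

text \<open>This replaces an imaginary quantifier by two field quantifiers, one for a representative
  and one for its level.\<close>

lemma RV_all_eq: "RV_all \<O> = {rv_map \<O> x l |x l. l \<noteq> 0 \<and> l \<preceq> 1}"
proof -
  have "\<xi> \<in> RV_all \<O> \<longleftrightarrow> (\<exists>x l. \<xi> = rv_map \<O> x l \<and> l \<noteq> 0 \<and> l \<preceq> 1)" for \<xi>
  proof
    assume "\<xi> \<in> RV_all \<O>"
    then obtain lam x where lam: "lam \<in> values_le_one \<O>" "\<xi> = rv \<O> lam x"
      by (auto simp: RV_all_def RV_def)
    then obtain l where "lam = val \<O> l" "l \<noteq> 0" "l \<preceq> 1"
      using values_le_oneE by blast
    with lam show "\<exists>x l. \<xi> = rv_map \<O> x l \<and> l \<noteq> 0 \<and> l \<preceq> 1"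
      by (intro exI[of _ x] exI[of _ l]) (simp add: rv_map_def)
  next
    assume "\<exists>x l. \<xi> = rv_map \<O> x l \<and> l \<noteq> 0 \<and> l \<preceq> 1"
    then show "\<xi> \<in> RV_all \<O>"
      by (force simp: RV_all_def RV_def rv_map_def val_in_values_le_one_iff)
  qed
  then show ?thesis by blast
qed

end


section \<open>Functions determined by finitely many leading terms\<close>

context leading_terms
begin

definition determined :: "'a set \<Rightarrow> ((nat \<Rightarrow> 'a) \<Rightarrow> 'b) \<Rightarrow> bool" where
  "determined A f \<longleftrightarrow>
     (\<exists>Q. finite Q \<and> Q \<subseteq> pol_funs A \<and> (\<forall>e e'. agree Q e e' \<longrightarrow> f e = f e'))"

lemma determinedI:
  assumes "finite Q" "Q \<subseteq> pol_funs A" "\<And>e e'. agree Q e e' \<Longrightarrow> f e = f e'"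
  shows "determined A f"
  using assms unfolding determined_def by blast

lemma determined_const: "determined A (\<lambda>_. b)"
  by (rule determinedI[of "{}"]) auto

lemma determined_comp:
  assumes "determined A f"
  shows "determined A (\<lambda>e. h (f e))"
proof -
  obtain Q where Q: "finite Q" "Q \<subseteq> pol_funs A" "\<forall>e e'. agree Q e e' \<longrightarrow> f e = f e'"
    using assms unfolding determined_def by (elim exE conjE) (rule that)
  from Q(1,2) show ?thesis
    by (rule determinedI) (rule arg_cong[where f = h], rule Q(3)[rule_format])
qed

lemma determined_comp2:
  assumes "determined A f" "determined A g"
  shows "determined A (\<lambda>e. h (f e) (g e))"
proof -
  obtain Q where Q: "finite Q" "Q \<subseteq> pol_funs A" "\<forall>e e'. agree Q e e' \<longrightarrow> f e = f e'"
    using assms(1) unfolding determined_def by (elim exE conjE) (rule that)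
  obtain Q' where Q': "finite Q'" "Q' \<subseteq> pol_funs A" "\<forall>e e'. agree Q' e e' \<longrightarrow> g e = g e'"
    using assms(2) unfolding determined_def by (elim exE conjE) (rule that)
  show ?thesis
  proof (rule determinedI)
    show "finite (Q \<union> Q')" "Q \<union> Q' \<subseteq> pol_funs A"
      using Q Q' by auto
    show "h (f e) (g e) = h (f e') (g e')" if "agree (Q \<union> Q') e e'" for e e'
      using Q(3)[rule_format, of e e'] Q'(3)[rule_format, of e e'] that by simp
  qed
qed

lemmas determined_not = determined_comp[where h = Not]
  and determined_conj = determined_comp2[where h = "(\<and>)"]
  and determined_disj = determined_comp2[where h = "(\<or>)"]

lemma determined_if:
  assumes "determined A P" "determined A f" "determined A g"
  shows "determined A (\<lambda>e. if P e then f e else g e)"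
  using determined_comp2[OF assms(1) determined_comp2[OF assms(2,3), of Pair],
      of "\<lambda>p z. if p then fst z else snd z"] by (simp only: fst_conv snd_conv)

lemma determined_le:
  assumes "f \<in> pol_funs A" "g \<in> pol_funs A"
  shows "determined A (\<lambda>e. f e \<preceq> g e)"
proof (rule determinedI)
  show "finite {f, g}" "{f, g} \<subseteq> pol_funs A"
    using assms by auto
  show "f e \<preceq> g e \<longleftrightarrow> f e' \<preceq> g e'" if "agree {f, g} e e'" for e e'
  proof -
    have "rvk (f e) = rvk (f e')" "rvk (g e) = rvk (g e')"
      using that by (simp_all add: agree_def)
    then have "f e \<preceq> f e'" "f e' \<preceq> f e" "g e \<preceq> g e'" "g e' \<preceq> g e"
      using rv_eq_imp_le[OF level] by simp_all
    then show ?thesis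
      using le_trans by blast
  qed
qed

lemma determined_lt:
  "f \<in> pol_funs A \<Longrightarrow> g \<in> pol_funs A \<Longrightarrow> determined A (\<lambda>e. f e \<prec> g e)"
  unfolding lt_def by (intro determined_not determined_le)

lemma determined_eq:
  assumes "f \<in> pol_funs A" "g \<in> pol_funs A"
  shows "determined A (\<lambda>e. f e = g e)"
  using determined_le[OF pol_funs.diff[OF assms] pol_funs_zero] by simp

text \<open>The bound \<open>b\<close> may lie outside \<open>A\<close>: it is fixed, and the
  leading term of \<open>f e\<close> already determines its value.\<close>

lemma determined_le_level:
  assumes "f \<in> pol_funs A"
  shows "determined A (\<lambda>e. f e \<preceq> b)" "determined A (\<lambda>e. b \<preceq> f e)"
proof -
  have le: "f e \<preceq> f e'" "f e' \<preceq> f e" if "agree {f} e e'" for e e'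
  proof -
    have eq: "rvk (f e) = rvk (f e')"
      using that by (simp add: agree_def)
    show "f e \<preceq> f e'" "f e' \<preceq> f e"
      using rv_eq_imp_le[OF level eq] rv_eq_imp_le[OF level eq[symmetric]] .
  qed
  have f: "finite {f}" "{f} \<subseteq> pol_funs A"
    using assms by auto
  show "determined A (\<lambda>e. f e \<preceq> b)"
  proof (rule determinedI[OF f])
    show "f e \<preceq> b \<longleftrightarrow> f e' \<preceq> b" if "agree {f} e e'" for e e'
      using le[OF that] le_trans[of "f e" "f e'" b] le_trans[of "f e'" "f e" b] by blast
  qed
  show "determined A (\<lambda>e. b \<preceq> f e)"
  proof (rule determinedI[OF f])
    show "b \<preceq> f e \<longleftrightarrow> b \<preceq> f e'" if "agree {f} e e'" for e e'
      using le[OF that] le_trans[of b "f e" "f e'"] le_trans[of b "f e'" "f e"] by blast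
  qed
qed

lemma determined_rv:
  assumes "f \<in> pol_funs A" "k \<preceq> k'" "k' \<preceq> 1"
  shows "determined A (\<lambda>e. rv \<O> (val \<O> k') (f e))"
proof (rule determinedI)
  show "finite {f}" "{f} \<subseteq> pol_funs A"
    using assms by auto
  show "rv \<O> (val \<O> k') (f e) = rv \<O> (val \<O> k') (f e')" if "agree {f} e e'" for e e'
    using that by (intro rv_coarsen[OF level(1) assms(2,3)]) (simp add: agree_def)
qed

text \<open>\<open>points_match\<close> transfers a witness from one environment to the other;
  agreement is symmetric, so this gives both implications.\<close>

lemma determined_ex:
  assumes "determined A f"
  shows "determined A (\<lambda>e. \<exists>x. f (case_nat x e))"
proof -
  obtain Q where Q: "finite Q" "Q \<subseteq> pol_funs A" "\<forall>e e'. agree Q e e' \<longrightarrow> f e = f e'"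
    using assms unfolding determined_def by (elim exE conjE) (rule that)
  obtain p where p: "p ` Q \<subseteq> (\<Union>n. pol_families A n)"
      "\<forall>q\<in>Q. \<forall>x e. q (case_nat x e) = poly (p q e) x"
    using pol_funs_first_variable[OF Q(2)] by (elim exE conjE) (rule that)
  obtain Q' where Q': "finite Q'" "Q' \<subseteq> pol_funs A"
    and match: "\<forall>e e' y. agree Q' e e' \<longrightarrow>
      (\<exists>y'. \<forall>q\<in>p ` Q. rvk (poly (q e) y) = rvk (poly (q e') y'))"
    using points_match[OF finite_imageI[OF Q(1)] p(1)] by (elim exE conjE) (rule that)
  have *: "\<exists>x. f (case_nat x e')" if agree: "agree Q' e e'" and fx: "f (case_nat x e)" for e e' x
  proof -
    obtain x' where "\<forall>q\<in>p ` Q. rvk (poly (q e) x) = rvk (poly (q e') x')"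
      using match[rule_format, OF agree, of x] by (elim exE) (rule that)
    then have "agree Q (case_nat x e) (case_nat x' e')"
      by (simp add: agree_def p(2))
    then have "f (case_nat x e) = f (case_nat x' e')"
      using Q(3) by blast
    with fx show ?thesis by auto
  qed
  have sym: "agree Q' e' e" if "agree Q' e e'" for e e'
    using that by (simp add: agree_def)
  show ?thesis
  proof (rule determinedI[OF Q'], rule iffI; elim exE)
    fix e e' x
    assume "agree Q' e e'" "f (case_nat x e)"
    then show "\<exists>x. f (case_nat x e')"
      by (rule *)
  next
    fix e e' x
    assume "agree Q' e e'" "f (case_nat x e')"
    then show "\<exists>x. f (case_nat x e)"
      using * sym by blast
  qed
qed


text \<open>The possible denotations of imaginary terms: parameters are arbitrary constants of level
  1 or \<open>k\<close>, while quantified variables and \<open>RvMap\<close> terms are leading terms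
  of polynomial functions at a varying level.\<close>

definition rv_function :: "'a set \<Rightarrow> ((nat \<Rightarrow> 'a) \<Rightarrow> 'a set) \<Rightarrow> bool" where
  "rv_function A h \<longleftrightarrow>
     (\<exists>\<xi>\<in>RV \<O> (val \<O> 1) \<union> RV \<O> (val \<O> k). h = (\<lambda>_. \<xi>)) \<or>
     (\<exists>f\<in>pol_funs A. \<exists>g\<in>pol_funs A. h = (\<lambda>e. rv_map \<O> (f e) (g e)))"

lemma rv_function_cases:
  assumes "rv_function A h"
  obtains (const) k' a where "k \<preceq> k'" "k' \<preceq> 1" "h = (\<lambda>_. rv \<O> (val \<O> k') a)"
    | (map) f g where "f \<in> pol_funs A" "g \<in> pol_funs A" "h = (\<lambda>e. rv_map \<O> (f e) (g e))"
  using assms unfolding rv_function_def RV_def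
  by (elim disjE bexE UnE rangeE) (use level le_refl const[of 1] const[of k] map in blast)+

lemma determined_map_eq_const:
  assumes "f \<in> pol_funs A" "g \<in> pol_funs A" "k \<preceq> k'" "k' \<preceq> 1"
  shows "determined A (\<lambda>e. rv_map \<O> (f e) (g e) = rv \<O> (val \<O> k') a)"
proof -
  have k': "k' \<noteq> 0"
    using level assms(3) by auto
  show ?thesis
    unfolding rv_map_eq_rv_iff[OF k' assms(4)]
    by (intro determined_if determined_conj determined_not determined_eq determined_le determined_const
        determined_le_level pol_funs_zero pol_funs.one assms
        determined_comp[OF determined_rv[OF assms(1,3,4)], where h = "\<lambda>\<xi>. \<xi> = rv \<O> (val \<O> k') a"])
qed

lemma determined_rv_function_eq:
  assumes "rv_function A h" "rv_function A h'"
  shows "determined A (\<lambda>e. h e = h' e)"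
  using assms(1)
proof (cases rule: rv_function_cases)
  case h: (const k1 a)
  show ?thesis
    using assms(2)
  proof (cases rule: rv_function_cases)
    case (const k2 b)
    with h show ?thesis
      by (simp add: determined_const)
  next
    case (map f g)
    with h show ?thesis
      using determined_map_eq_const[of f A g k1 a] by (simp add: eq_commute)
  qed
next
  case h: (map f g)
  show ?thesis
    using assms(2)
  proof (cases rule: rv_function_cases)
    case (const k2 b)
    with h show ?thesis
      using determined_map_eq_const[of f A g k2 b] by simp
  next
    case h': (map f' g')
    show ?thesis
      unfolding h h' rv_map_eq_iff
      by (intro determined_if determined_conj determined_disj determined_not determined_eq
          determined_le determined_lt pol_funs_zero pol_funs.one pol_funs.diff pol_funs.mult h h')
  qed
qed

lemma rv_function_shift_env:
  assumes "rv_function A h"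
  shows "rv_function A (\<lambda>e. h (e \<circ> Suc))"
  using assms
proof (cases rule: rv_function_cases)
  case const
  with assms show ?thesis
    by (auto simp: rv_function_def)
next
  case (map f g)
  then show ?thesis
    unfolding rv_function_def
    by (intro disjI2 bexI[of _ "\<lambda>e. f (e \<circ> Suc)"] bexI[of _ "\<lambda>e. g (e \<circ> Suc)"])
      (auto intro: pol_funs_shift_env)
qed

lemma rv_function_eval_rvtm:
  fixes M :: "('a, unit, unit) struct"
  assumes "vring M = \<O>" "wf_rvtm pure_language t"
    and "\<And>i. i \<in> fv_rvtm t \<Longrightarrow> (\<lambda>e. \<sigma> e i) \<in> pol_funs A"
    and "\<And>j. j \<in> rvfv_rvtm t \<Longrightarrow> rv_function A (\<lambda>e. R e j)"
  shows "rv_function A (\<lambda>e. eval_rvtm M (\<sigma> e) (R e) t)"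
proof (cases t)
  case (RvVar j)
  then show ?thesis
    using assms by simp
next
  case (RvMap s l)
  then have "(\<lambda>e. eval_tm M (\<sigma> e) s) \<in> pol_funs A" "(\<lambda>e. eval_tm M (\<sigma> e) l) \<in> pol_funs A"
    using assms(2,3) by (auto intro!: pol_funs_eval_tm)
  then show ?thesis
    unfolding rv_function_def RvMap using assms(1) by auto
qed

text \<open>Quantifier elimination by induction on the formula. The maps \<open>\<sigma>\<close> and
  \<open>R\<close> separate its variables from the coordinates of \<open>e\<close>: field parameters
  can be constants from \<open>A\<close>, and bound variables become coordinates.\<close>

theorem determined_sat:
  fixes M :: "('a, unit, unit) struct"
  assumes "vring M = \<O>" "wf_fm pure_language \<phi>"
    and "\<And>i. i \<in> fv \<phi> \<Longrightarrow> (\<lambda>e. \<sigma> e i) \<in> pol_funs A"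
    and "\<And>j. j \<in> rvfv \<phi> \<Longrightarrow> rv_function A (\<lambda>e. R e j)"
  shows "determined A (\<lambda>e. sat M (\<sigma> e) (R e) \<phi>)"
  using assms(2-)
proof (induction \<phi> arbitrary: \<sigma> R)
  case (Eq s t)
  then show ?case
    by (auto intro!: determined_eq pol_funs_eval_tm)
next
  case (InO t)
  then have "determined A (\<lambda>e. eval_tm M (\<sigma> e) t \<preceq> 1)"
    by (intro determined_le pol_funs_eval_tm pol_funs.one) auto
  then show ?case
    by (simp add: assms(1) in_iff_le_one)
next
  case (Rel r ts)
  then show ?case
    by (simp add: pure_language_def)
next
  case (RvEq s t)
  show ?case
    unfolding sat.simps
    by (intro determined_rv_function_eq rv_function_eval_rvtm assms(1)) (use RvEq in auto)
next
  case (Neg \<phi>)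
  then show ?case
    by (auto intro!: determined_not)
next
  case (And \<phi> \<psi>)
  then show ?case
    by (auto intro!: determined_conj)
next
  case (Exists i \<phi>)
  \<comment> \<open>The bound variable becomes coordinate 0 and the old coordinates move up by
    one.\<close>
  define \<sigma>' where "\<sigma>' = (\<lambda>e. (\<sigma> (e \<circ> Suc))(i := e 0))"
  have \<sigma>': "(\<lambda>e. \<sigma>' e i') \<in> pol_funs A" if "i' \<in> fv \<phi>" for i'
  proof (cases "i' = i")
    case True
    then show ?thesis
      by (simp add: \<sigma>'_def pol_funs.var)
  next
    case False
    then show ?thesis
      using Exists.prems(2)[of i'] that pol_funs_shift_env[of "\<lambda>e. \<sigma> e i'" A]
      by (simp add: \<sigma>'_def)
  qed
  have R: "rv_function A (\<lambda>e. R (e \<circ> Suc) j)" if "j \<in> rvfv \<phi>" for j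
    by (rule rv_function_shift_env[of A "\<lambda>e. R e j"]) (use Exists.prems(3) that in simp)
  have "determined A (\<lambda>e. sat M (\<sigma>' e) (R (e \<circ> Suc)) \<phi>)"
    using Exists.prems(1) by (intro Exists.IH \<sigma>' R) simp_all
  then have "determined A (\<lambda>e. \<exists>x. sat M (\<sigma>' (case_nat x e)) (R (case_nat x e \<circ> Suc)) \<phi>)"
    by (rule determined_ex)
  moreover have "case_nat x e \<circ> Suc = e" for x :: 'a and e
    by auto
  ultimately show ?case
    by (simp add: \<sigma>'_def)
next
  case (RvExists j \<phi>)
  \<comment> \<open>The bound imaginary variable is encoded by two new coordinates, 0 for a
    representative and 1 for the level.\<close>
  define R' where "R' = (\<lambda>e. (R (e \<circ> Suc \<circ> Suc))(j := rv_map \<O> (e 0) (e 1)))"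
  have R': "rv_function A (\<lambda>e. R' e j')" if "j' \<in> rvfv \<phi>" for j'
  proof (cases "j' = j")
    case True
    then show ?thesis
      unfolding rv_function_def R'_def
      by (intro disjI2 bexI[of _ "\<lambda>e. e 0"] bexI[of _ "\<lambda>e. e 1"]) (auto intro: pol_funs.var)
  next
    case False
    then show ?thesis
      using RvExists.prems(3)[of j'] that
        rv_function_shift_env[OF rv_function_shift_env, of A "\<lambda>e. R e j'"]
      by (simp add: R'_def)
  qed
  have \<sigma>: "(\<lambda>e. \<sigma> (e \<circ> Suc \<circ> Suc) i) \<in> pol_funs A" if "i \<in> fv \<phi>" for i
    using RvExists.prems(2)[of i] that
      pol_funs_shift_env[OF pol_funs_shift_env, of "\<lambda>e. \<sigma> e i" A] by simp
  have "determined A (\<lambda>e. sat M (\<sigma> (e \<circ> Suc \<circ> Suc)) (R' e) \<phi>)"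
    using RvExists.prems(1) by (intro RvExists.IH \<sigma> R') simp_all
  moreover have "determined A (\<lambda>e. e 1 \<noteq> 0 \<and> e 1 \<preceq> 1)"
    by (intro determined_conj determined_not determined_eq determined_le
        pol_funs.var pol_funs.one pol_funs_zero)
  ultimately have "determined A (\<lambda>e. (e 1 \<noteq> 0 \<and> e 1 \<preceq> 1) \<and> sat M (\<sigma> (e \<circ> Suc \<circ> Suc)) (R' e) \<phi>)"
    by (rule determined_conj[rotated])
  from determined_ex[OF determined_ex[OF this]]
  have "determined A (\<lambda>e. \<exists>l x. (l \<noteq> 0 \<and> l \<preceq> 1) \<and>
      sat M (\<sigma> (case_nat x (case_nat l e) \<circ> Suc \<circ> Suc)) (R' (case_nat x (case_nat l e))) \<phi>)"
    by simp
  moreover have "case_nat x (case_nat l e) \<circ> Suc \<circ> Suc = e" for x l :: 'a and e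
    by auto
  moreover have "(\<exists>\<xi>\<in>RV_all \<O>. S \<xi>) \<longleftrightarrow> (\<exists>l x. (l \<noteq> 0 \<and> l \<preceq> 1) \<and> S (rv_map \<O> x l))" for S
    by (auto simp: RV_all_eq)
  ultimately show ?case
    by (simp add: R'_def assms(1))
qed

end


section \<open>Definability of the root set\<close>

text \<open>There are no terms for constants and subtraction: \<open>0\<close> and \<open>1\<close> are the values of two auxiliary
  variables \<open>v0\<close> and \<open>v1\<close>, and a polynomial is a difference of two terms.\<close>

definition term_difference :: "('a::field, unit, unit) struct \<Rightarrow> nat set \<Rightarrow> ('b \<Rightarrow> nat \<Rightarrow> 'a) \<Rightarrow>
    ('b \<Rightarrow> 'a) \<Rightarrow> bool" where
  "term_difference M V E f \<longleftrightarrow>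
     (\<exists>s t. wf_tm pure_language s \<and> wf_tm pure_language t \<and> fv_tm s \<subseteq> V \<and> fv_tm t \<subseteq> V \<and>
        (\<forall>x. f x = eval_tm M (E x) s - eval_tm M (E x) t))"

lemma term_differenceI:
  assumes "wf_tm pure_language s" "wf_tm pure_language t" "fv_tm s \<subseteq> V" "fv_tm t \<subseteq> V"
    and "\<And>x. f x = eval_tm M (E x) s - eval_tm M (E x) t"
  shows "term_difference M V E f"
  unfolding term_difference_def using assms by (intro exI[of _ s] exI[of _ t]) simp

context
  fixes M :: "('a::field, unit, unit) struct" and V :: "nat set" and E :: "'b \<Rightarrow> nat \<Rightarrow> 'a"
    and v1 v0 :: nat
  assumes aux: "v1 \<in> V" "v0 \<in> V" "\<And>x. E x v1 = 1" "\<And>x. E x v0 = 0"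
begin

lemma term_difference_var: "i \<in> V \<Longrightarrow> term_difference M V E (\<lambda>x. E x i)"
  using aux by (intro term_differenceI[of "Var i" "Var v0"]) auto

lemma term_difference_one: "term_difference M V E (\<lambda>_. 1)"
  using term_difference_var[OF aux(1)] aux(3) by simp

lemma term_difference_diff:
  assumes "term_difference M V E f" "term_difference M V E g"
  shows "term_difference M V E (\<lambda>x. f x - g x)"
proof -
  obtain s t where
    "wf_tm pure_language s" "wf_tm pure_language t" "fv_tm s \<subseteq> V" "fv_tm t \<subseteq> V"
    "\<forall>x. f x = eval_tm M (E x) s - eval_tm M (E x) t"
    using assms(1) unfolding term_difference_def by (elim exE conjE) (rule that)
  moreover obtain s' t' where
    "wf_tm pure_language s'" "wf_tm pure_language t'" "fv_tm s' \<subseteq> V" "fv_tm t' \<subseteq> V"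
    "\<forall>x. g x = eval_tm M (E x) s' - eval_tm M (E x) t'"
    using assms(2) unfolding term_difference_def by (elim exE conjE) (rule that)
  ultimately show ?thesis
    by (intro term_differenceI[of "Add s t'" "Add t s'"]) auto
qed

lemma term_difference_mult:
  assumes "term_difference M V E f" "term_difference M V E g"
  shows "term_difference M V E (\<lambda>x. f x * g x)"
proof -
  obtain s t where
    "wf_tm pure_language s" "wf_tm pure_language t" "fv_tm s \<subseteq> V" "fv_tm t \<subseteq> V"
    "\<forall>x. f x = eval_tm M (E x) s - eval_tm M (E x) t"
    using assms(1) unfolding term_difference_def by (elim exE conjE) (rule that)
  moreover obtain s' t' where
    "wf_tm pure_language s'" "wf_tm pure_language t'" "fv_tm s' \<subseteq> V" "fv_tm t' \<subseteq> V"
    "\<forall>x. g x = eval_tm M (E x) s' - eval_tm M (E x) t'"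
    using assms(2) unfolding term_difference_def by (elim exE conjE) (rule that)
  moreover have "(a - b) * (c - d) = (a * c + b * d) - (a * d + b * c)" for a b c d :: 'a
    by (simp add: algebra_simps)
  ultimately show ?thesis
    by (intro term_differenceI[of "Add (Mul s s') (Mul t t')" "Add (Mul s t') (Mul t s')"]) simp_all
qed

lemma term_difference_zero: "term_difference M V E (\<lambda>_. 0)"
  using term_difference_var[OF aux(2)] aux(4) by simp

lemma term_difference_sum:
  assumes "\<And>i. i \<in> S \<Longrightarrow> term_difference M V E (f i)"
  shows "term_difference M V E (\<lambda>x. \<Sum>i\<in>S. f i x)"
  using assms
proof (induction S rule: infinite_finite_induct)
  case (insert i S)
  then have "term_difference M V E (\<lambda>x. f i x - (0 - (\<Sum>i\<in>S. f i x)))"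
    by (intro term_difference_diff term_difference_zero) auto
  with insert show ?case by simp
qed (simp_all add: term_difference_zero)

lemma term_difference_prod:
  assumes "\<And>i. i \<in> S \<Longrightarrow> term_difference M V E (f i)"
  shows "term_difference M V E (\<lambda>x. \<Prod>i\<in>S. f i x)"
  using assms
  by (induction S rule: infinite_finite_induct)
    (simp_all add: term_difference_one term_difference_mult)

text \<open>At the zero environment all coordinates vanish, and the remaining constants from
  \<open>A\<close> are supplied by variables in \<open>V\<close>.\<close>

lemma term_difference_pol_funs:
  assumes "f \<in> pol_funs A" "\<And>a. a \<in> A \<Longrightarrow> \<exists>i\<in>V. \<forall>x. E x i = a"
  shows "term_difference M V E (\<lambda>_. f (\<lambda>_. 0))"
  using assms(1)
proof induction
  case (var i)
  then show ?case
    by (rule term_difference_zero)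
next
  case (const a)
  then obtain i where "i \<in> V" "\<forall>x. E x i = a"
    using assms(2) by blast
  then show ?case
    using term_difference_var[of i] by simp
next
  case one
  show ?case
    by (rule term_difference_one)
qed (simp_all add: term_difference_diff term_difference_mult)

lemma term_difference_poly:
  assumes "\<And>i. term_difference M V E (\<lambda>_. coeff p i)" "term_difference M V E f"
  shows "term_difference M V E (\<lambda>x. poly p (f x))"
proof -
  have "term_difference M V E (\<lambda>x. f x ^ n)" for n
    by (induction n) (simp_all add: term_difference_one term_difference_mult[OF assms(2)])
  then show ?thesis
    unfolding poly_altdef by (intro term_difference_sum term_difference_mult assms(1))
qed

end


text \<open>A finite union of root sets is the zero set of a single product, and the vanishing of a
  difference of terms is an equation.\<close>

lemma definable_roots:
  fixes M :: "('a::field, unit, unit) struct" and e :: "nat \<Rightarrow> 'a"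
  assumes I: "finite I" "0 \<notin> I" and D: "finite D" "D \<subseteq> (\<Union>n. pol_families (e ` I) n)"
  shows "definable pure_language M (e ` I) B
    (insert 0 (\<Union>q\<in>{q\<in>D. q (\<lambda>_. 0) \<noteq> 0}. {x. poly (q (\<lambda>_. 0)) x = 0}))"
proof -
  \<comment> \<open>Inserting 0 keeps the auxiliary variables apart from variable 0 and lets the
    maximum exist for empty \<open>I\<close>.\<close>
  define v1 where "v1 = Suc (Max (insert 0 I))"
  define v0 where "v0 = Suc v1"
  define E where "E = (\<lambda>x. e(0 := x, v1 := 1, v0 := 0))"
  define V where "V = insert 0 (insert v1 (insert v0 I))"
  have fresh: "i \<noteq> v1" "i \<noteq> v0" if "i \<in> insert 0 I" for i
  proof -
    have "i \<le> Max (insert 0 I)"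
      using I(1) that by (intro Max_ge) simp_all
    then show "i \<noteq> v1" "i \<noteq> v0"
      by (simp_all add: v1_def v0_def)
  qed
  have aux: "v1 \<in> V" "v0 \<in> V" "\<And>x. E x v1 = 1" "\<And>x. E x v0 = 0"
    by (auto simp: V_def E_def v0_def)
  have E0: "E x 0 = x" for x
    using fresh[of 0] by (simp add: E_def)
  have EI: "E x i = e i" if "i \<in> I" for x i
    using fresh[of i] that I(2) by (auto simp: E_def)
  \<comment> \<open>The factor \<open>x\<close> contributes the point 0; polynomials that are
    identically zero are replaced by 1.\<close>
  define F where
    "F = (\<lambda>x. x * (\<Prod>q\<in>D. if q (\<lambda>_. 0) = 0 then 1 else poly (q (\<lambda>_. 0)) x))"
  have var0: "term_difference M V E (\<lambda>x. x)"
    using term_difference_var[where E = E, OF aux, of 0] E0 by (simp add: V_def)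
  have const: "term_difference M V E (\<lambda>_. f (\<lambda>_. 0))" if "f \<in> pol_funs (e ` I)" for f
    using that EI by (intro term_difference_pol_funs[where E = E, OF aux]) (auto simp: V_def)
  have "term_difference M V E (\<lambda>_. coeff (q (\<lambda>_. 0)) i)" if "q \<in> D" for q i
  proof -
    obtain n where "q \<in> pol_families (e ` I) n"
      using \<open>q \<in> D\<close> D(2) by blast
    from const[OF coeff_pol_families[OF this]] show ?thesis .
  qed
  then have factor: "term_difference M V E (\<lambda>x. if q (\<lambda>_. 0) = 0 then 1 else poly (q (\<lambda>_. 0)) x)"
    if "q \<in> D" for q
    using term_difference_poly[where E = E, OF aux _ var0] term_difference_one[where E = E, OF aux] that
    by (cases "q (\<lambda>_. 0) = 0") simp_all
  have "term_difference M V E F"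
    unfolding F_def
    by (intro term_difference_mult[where E = E, OF aux] term_difference_prod[where E = E, OF aux] var0 factor)
  then obtain s t where st: "wf_tm pure_language s" "wf_tm pure_language t" "fv_tm s \<subseteq> V" "fv_tm t \<subseteq> V"
    "\<forall>x. F x = eval_tm M (E x) s - eval_tm M (E x) t"
    unfolding term_difference_def by (elim exE conjE) (rule that)
  \<comment> \<open>Binding the auxiliary variables to 1 and 0 keeps them from becoming
    parameters.\<close>
  define \<phi> :: "(unit, unit) fm" where "\<phi> =
    Exists v1 (And (IsOne (Var v1)) (Exists v0 (And (IsZero (Var v0)) (Eq s t))))"
  have sat: "sat M (e(0 := x)) \<rho> \<phi> \<longleftrightarrow> F x = 0" for x \<rho>
    using fresh[of 0] by (simp add: \<phi>_def st(5) v0_def) (simp add: E_def v0_def)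
  have "definable pure_language M (e ` I) B {x. F x = 0}"
    unfolding definable_def
  proof (intro exI[of _ \<phi>] exI[of _ e] exI[of _ "\<lambda>_. {}"] conjI)
    show "wf_fm pure_language \<phi>"
      using st by (simp add: \<phi>_def)
    show "\<forall>i\<in>fv \<phi> - {0}. e i \<in> e ` I"
      using st by (auto simp: \<phi>_def V_def)
    show "\<forall>j\<in>rvfv \<phi>. {} \<in> B"
      by (simp add: \<phi>_def IsOne_def IsZero_def)
    show "{x. F x = 0} = {x. sat M (e(0 := x)) (\<lambda>_. {}) \<phi>}"
      by (simp add: sat)
  qed
  moreover have "{x. F x = 0} =
      insert 0 (\<Union>q\<in>{q\<in>D. q (\<lambda>_. 0) \<noteq> 0}. {x. poly (q (\<lambda>_. 0)) x = 0})"
    using D(1) by (auto simp: F_def)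
  ultimately show ?thesis by simp
qed


section \<open>Hensel minimality\<close>

lemma definable_mono:
  assumes "definable L M A B X" "A \<subseteq> A'" "B \<subseteq> B'"
  shows "definable L M A' B' X"
proof -
  obtain \<phi> e \<rho> where "wf_fm L \<phi>" "\<forall>i\<in>fv \<phi> - {0}. e i \<in> A" "\<forall>j\<in>rvfv \<phi>. \<rho> j \<in> B"
      "X = {x. sat M (e(0 := x)) \<rho> \<phi>}"
    using assms(1) unfolding definable_def by (elim exE conjE) (rule that)
  then show ?thesis
    unfolding definable_def using assms(2,3) by (intro exI[of _ \<phi>] exI[of _ e] exI[of _ \<rho>]) auto
qed

text \<open>Membership is determined by leading terms of polynomials over the field parameters of
  the formula. Imaginary parameters enter no polynomial, so the set of centers is definable over
  \<open>A\<close> alone.\<close>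

lemma (in leading_terms) prepared_by_roots:
  fixes M :: "('a, unit, unit) struct"
  assumes M: "vring M = \<O>" and B: "B \<subseteq> RV \<O> (val \<O> 1) \<union> RV \<O> (val \<O> k)"
    and X: "definable pure_language M A B X"
  shows "\<exists>C. finite C \<and> C \<noteq> {} \<and> definable pure_language M A {} C \<and> prepares \<O> (val \<O> k) C X"
proof -
  obtain \<phi> e \<rho> where \<phi>: "wf_fm pure_language \<phi>" "\<forall>i\<in>fv \<phi> - {0}. e i \<in> A" "\<forall>j\<in>rvfv \<phi>. \<rho> j \<in> B"
    and X_eq: "X = {x. sat M (e(0 := x)) \<rho> \<phi>}"
    using X unfolding definable_def by (elim exE conjE) (rule that)
  define I where "I = fv \<phi> - {0}"
  have fin_tm: "finite (fv_tm t)" for t :: "unit tm"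
    by (induction t) auto
  have fin_rvtm: "finite (fv_rvtm t)" for t :: "unit rvtm"
    by (cases t) (auto simp: fin_tm)
  have "finite (fv \<phi>)"
    by (induction \<phi>) (auto simp: fin_tm fin_rvtm)
  then have I: "finite I" "0 \<notin> I"
    by (auto simp: I_def)
  have "determined (e ` I) (\<lambda>f. sat M (e(0 := f 0)) \<rho> \<phi>)"
  proof (rule determined_sat[OF M \<phi>(1)])
    fix i assume "i \<in> fv \<phi>"
    then show "(\<lambda>f. (e(0 := f 0)) i) \<in> pol_funs (e ` I)"
      by (cases "i = 0") (auto simp: I_def intro: pol_funs.var pol_funs.const)
  next
    fix j assume "j \<in> rvfv \<phi>"
    then show "rv_function (e ` I) (\<lambda>f. \<rho> j)"
      unfolding rv_function_def using \<phi>(3) B by blast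
  qed
  then obtain Q where Q: "finite Q" "Q \<subseteq> pol_funs (e ` I)"
    "\<forall>f f'. agree Q f f' \<longrightarrow> sat M (e(0 := f 0)) \<rho> \<phi> = sat M (e(0 := f' 0)) \<rho> \<phi>"
    unfolding determined_def by (elim exE conjE) (rule that)
  obtain p where p: "p ` Q \<subseteq> (\<Union>n. pol_families (e ` I) n)"
    "\<forall>q\<in>Q. \<forall>x f. q (case_nat x f) = poly (p q f) x"
    using pol_funs_first_variable[OF Q(2)] by (elim exE conjE) (rule that)
  obtain n where "p ` Q \<subseteq> pol_families (e ` I) n"
    using finite_subset_pol_families[OF finite_imageI[OF Q(1)] p(1)] .
  with finite_imageI[OF Q(1)] obtain D where
    D: "finite D" "p ` Q \<subseteq> D" "D \<subseteq> pol_families (e ` I) n" "pderiv_closed D"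
    by (rule pderiv_closure)
  \<comment> \<open>Membership depends on coordinate 0 only. Setting the other coordinates to 0
    leaves polynomials over the ring generated by the parameters.\<close>
  define f0 :: "nat \<Rightarrow> 'a" where "f0 = (\<lambda>_. 0)"
  define C where "C = insert 0 (\<Union>q\<in>{q\<in>D. q f0 \<noteq> 0}. {x. poly (q f0) x = 0})"
  have C: "finite C" "C \<noteq> {}"
    using D(1) by (auto simp: C_def intro!: poly_roots_finite)
  have "D \<subseteq> (\<Union>n. pol_families (e ` I) n)"
    using D(3) by blast
  from definable_roots[OF I D(1) this]
  have "definable pure_language M (e ` I) {} C"
    unfolding C_def f0_def .
  moreover have "e ` I \<subseteq> A"
    using \<phi>(2) by (auto simp: I_def)
  ultimately have "definable pure_language M A {} C"
    by (rule definable_mono) simp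
  moreover have "prepares \<O> (val \<O> k) C X"
    unfolding prepares_def
  proof (intro allI impI)
    fix x x' assume eq: "\<forall>c\<in>C. rvk (x - c) = rvk (x' - c)"
    have same: "rvk (poly (q f0) x) = rvk (poly (q f0) x')" if "q \<in> D" for q
    proof (rule rv_poly_eq_of_prepared[OF C])
      fix j y assume y: "(pderiv ^^ j) (q f0) \<noteq> 0" "poly ((pderiv ^^ j) (q f0)) y = 0"
      have "(\<lambda>f. (pderiv ^^ j) (q f)) \<in> D"
        using pderiv_closed_higher[OF D(4) that] .
      with y show "y \<in> C"
        unfolding C_def by blast
    qed (use eq in blast)
    have "rvk (poly (p q f0) x) = rvk (poly (p q f0) x')" if "q \<in> Q" for q
      using D(2) that by (intro same) blast
    then have "agree Q (case_nat x f0) (case_nat x' f0)"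
      using p(2) by (simp add: agree_def)
    from Q(3)[rule_format, OF this] show "x \<in> X \<longleftrightarrow> x' \<in> X"
      by (simp add: X_eq)
  qed
  ultimately show ?thesis
    using C by blast
qed


theorem mainTheorem16:
  shows "h_minimal TYPE('a::field) pure_language \<infinity> henselian_equichar0_theory"
  unfolding h_minimal_def
proof (intro conjI allI impI ballI is_theory_henselian_equichar0_theory)
  fix M :: "('a, unit, unit) struct"
  assume "models M henselian_equichar0_theory"
  then have M: "equichar0_valued_field (vring M)" "henselian (vring M)"
    by (simp_all add: models_henselian_equichar0_theory)
  then show "equichar0_valued_field (vring M)" by simp
  interpret valued_field "vring M"
    using M(1) by unfold_locales (simp add: equichar0_valued_field_def)
  have nat_unit: "le 1 (of_nat n)" if "n > 0" for n
    using M(1) that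
    by (simp add: equichar0_valued_field_def val_maximal_ideal_iff_lt lt_def)
  fix lam A A' X
  assume lam: "lam \<in> values_le_one (vring M)"
    and X: "A' \<subseteq> RV (vring M) lam \<and> card_at_most A' \<infinity> \<and>
      definable pure_language M A (RV (vring M) (val (vring M) 1) \<union> A') X"
  \<comment> \<open>A field element of value \<open>lam\<close> serves as the level, which brings
    the estimates on elements to bear.\<close>
  obtain k where k: "lam = val (vring M) k" "k \<noteq> 0" "le k 1"
    using values_le_oneE[OF lam] .
  interpret leading_terms "vring M" k
    by unfold_locales (use M(2) nat_unit k in simp_all)
  show "\<exists>C. finite C \<and> C \<noteq> {} \<and> definable pure_language M A {} C \<and> prepares (vring M) lam C X"
    unfolding k(1)
  proof (rule prepared_by_roots[OF refl])
    show "RV (vring M) (val (vring M) 1) \<union> A' \<subseteq>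
        RV (vring M) (val (vring M) 1) \<union> RV (vring M) (val (vring M) k)"
      using X k(1) by blast
  qed (use X in blast)
qed

end
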